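(* Let $P,Q\in\mathbb{Z}[x,y]$ and let $F=(P,Q):\mathbb{C}^2\to\mathbb{C}^2$ be the associated polynomial map, with Jacobian $JF:=P_xQ_y-P_yQ_x\equiv 1$. If the complex plane curve $\{(x,y)\in\mathbb{C}^2: P(x,y)=0\}$ contains infinitely many points of $\mathbb{Z}[i]^2$, then $F$ is invertible and its inverse is a polynomial map with integer coefficients, i.e. $F^{-1}\in\mathbb{Z}[x,y]^2$.
   Context: $\mathbb{Z}[i]:=\{a+bi: a,b\in\mathbb{Z}\}$ denotes the Gaussian integers. *)

theory Defs
  imports Complex_Main "HOL-Computational_Algebra.Polynomial"
begin

text \<open>Bivariate integer polynomials Z[x,y] are represented as int poly poly:
  P = sum_j (coeff P j)(x) * y^j, i.e. outer variable y, inner variable x.\<close>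

type_synonym bipoly = "int poly poly"

definition eval2 :: "bipoly \<Rightarrow> complex \<Rightarrow> complex \<Rightarrow> complex" where
  "eval2 P x y = poly (map_poly (\<lambda>c. poly (map_poly of_int c) x) P) y"

definition dx :: "bipoly \<Rightarrow> bipoly" where
  "dx P = map_poly pderiv P"

definition dy :: "bipoly \<Rightarrow> bipoly" where
  "dy P = pderiv P"

definition jacobian :: "bipoly \<Rightarrow> bipoly \<Rightarrow> bipoly" where
  "jacobian P Q = dx P * dy Q - dy P * dx Q"

definition gaussian_ints :: "complex set" where
  "gaussian_ints = {Complex (of_int a) (of_int b) | a b. True}"

end

theory Submission
  imports "HOL-Complex_Analysis.Complex_Analysis" Defs
begin

text \<open>
  Let \<open>D = J(P, \<cdot>)\<close>, so \<open>D P = 0\<close> and \<open>D Q = 1\<close>. At a point \<open>z\<close> of the curve \<open>P = 0\<close> with \<open>Q(z) = t\<close>, the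
  flow of \<open>D\<close> is the local inverse \<open>s \<mapsto> (X(s), Y(s))\<close> of \<open>Q\<close> along the curve, that is \<open>P(X, Y) = 0\<close>
  and \<open>Q(X, Y) = t + s\<close>. If \<open>z\<close> is a Gaussian integer point, then \<open>X\<close> and \<open>Y\<close> have Gaussian integer
  coefficients because the Jacobian is 1. They are algebraic functions, and the finitely many values
  of \<open>Q\<close> where a branch can escape to infinity do not depend on \<open>z\<close>. Since \<open>Q\<close> takes infinitely many
  Gaussian integer values on the integer points of the curve, some \<open>z\<close> has \<open>t\<close> at distance more
  than 2 from all of them. There the radius of convergence exceeds 1, and power series with Gaussian
  integer coefficients and radius greater than 1 are polynomials. So \<open>F\<close> maps a polynomially
  parametrized line isomorphically onto \<open>{0} \<times> \<complex>\<close>; Siegel's theorem is not needed.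

  Now expand \<open>P\<close> and \<open>Q\<close> in powers of a transversal coordinate \<open>l\<close> along this line, with coefficients
  polynomial in the parameter \<open>T\<close>, and let \<open>d\<close> be the degree in \<open>T\<close> of the Jacobian of the coordinates
  \<open>(T, l)\<close>. An edge of steepest slope in the Newton polygons would contradict the Jacobian condition,
  hence \<open>P\<close> has weight at most 0 and \<open>Q\<close> weight at most 1 for the weights 1 of \<open>T\<close> and \<open>-d\<close> of \<open>l\<close>.
  Then \<open>D\<close> lowers weights, and only 0 has negative weight, so \<open>D\<close> is locally nilpotent. Its kernel is
  \<open>\<complex>[P]\<close> and \<open>D Q = 1\<close>, which gives \<open>\<complex>[x, y] = \<complex>[P, Q]\<close>. Integrality of the inverse follows from that of the
  flow for the pairs \<open>(P - Q^N, Q)\<close>.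
\<close>

hide_const (open) Cartesian_Euclidean_Space.jacobian

section \<open>Bivariate polynomials as iterated polynomials\<close>

text \<open>Homomorphisms are explicit functions, so that coefficient embeddings, evaluations and
  substitutions between different rings are treated alike.\<close>

definition rhom :: "('a::comm_ring_1 \<Rightarrow> 'b::comm_ring_1) \<Rightarrow> bool" where
  "rhom h \<longleftrightarrow> h 0 = 0 \<and> h 1 = 1 \<and> (\<forall>a b. h (a + b) = h a + h b) \<and> (\<forall>a b. h (a * b) = h a * h b)"

text \<open>Substitution of \<open>X\<close> for the inner variable x and \<open>Y\<close> for the
  outer variable y. With target the numbers, C[T], power series or C[x, y] it yields values,
  restriction to a curve, the formal flow and composition.\<close>

definition bev :: "('a::comm_ring_1 \<Rightarrow> 'b::comm_ring_1) \<Rightarrow> 'a poly poly \<Rightarrow> 'b \<Rightarrow> 'b \<Rightarrow> 'b" where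
  "bev h g X Y = poly (map_poly (\<lambda>c. poly (map_poly h c) X) g) Y"

abbreviation bcomp :: "'a::comm_ring_1 poly poly \<Rightarrow> 'a poly poly \<Rightarrow> 'a poly poly \<Rightarrow> 'a poly poly" where
  "bcomp \<equiv> bev (\<lambda>c. [:[:c:]:])"

abbreviation beval :: "'a::comm_ring_1 poly poly \<Rightarrow> 'a \<Rightarrow> 'a \<Rightarrow> 'a" where
  "beval \<equiv> bev (\<lambda>c. c)"

abbreviation xv :: "'a::comm_ring_1 poly poly" where "xv \<equiv> [:[:0, 1:]:]"
abbreviation yv :: "'a::comm_ring_1 poly poly" where "yv \<equiv> [:0, 1:]"

lemma rhomD:
  assumes "rhom h"
  shows "h 0 = 0" "h 1 = 1" "h (a + b) = h a + h b" "h (a * b) = h a * h b"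
    "h (- a) = - h a" "h (a - b) = h a - h b"
proof -
  show 1: "h 0 = 0" and "h 1 = 1" and 2: "\<And>a b. h (a + b) = h a + h b" and "h (a * b) = h a * h b"
    using assms by (auto simp: rhom_def)
  have "h a + h (- a) = 0" for a using 2[of a "- a"] 1 by simp
  then show 3: "h (- a) = - h a" for a by (simp add: eq_neg_iff_add_eq_0 add.commute)
  show "h (a - b) = h a - h b" using 2[of a "-b"] 3 by simp
qed

lemma rhom_sum: "rhom h \<Longrightarrow> h (sum f A) = (\<Sum>i\<in>A. h (f i))"
  by (induction A rule: infinite_finite_induct) (simp_all add: rhomD)

lemma rhom_power: "rhom h \<Longrightarrow> h (a ^ n) = h a ^ n"
  by (induction n) (simp_all add: rhomD)

lemma rhom_map_poly: "rhom h \<Longrightarrow> rhom (map_poly h)"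
proof -
  assume h: "rhom h"
  have 0: "h 0 = 0" using h by (simp add: rhomD)
  have add: "map_poly h (p + q) = map_poly h p + map_poly h q" for p q
    by (rule poly_eqI) (simp add: coeff_map_poly rhomD[OF h])
  have "map_poly h (p * q) = map_poly h p * map_poly h q" for p q
  proof (induction p)
    case (pCons a p)
    have "map_poly h (smult a q) = smult (h a) (map_poly h q)"
      by (rule poly_eqI) (simp add: coeff_map_poly rhomD[OF h])
    then show ?case using pCons
      by (simp add: map_poly_pCons 0 mult_pCons_left add)
  qed simp
  moreover have "map_poly h 1 = 1" by (rule poly_eqI) (simp add: coeff_map_poly rhomD[OF h])
  ultimately show ?thesis using add by (auto simp: rhom_def)
qed

lemma rhom_poly: "rhom (\<lambda>p. poly p X)"
  by (simp add: rhom_def)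

lemma rhom_comp: "rhom h \<Longrightarrow> rhom k \<Longrightarrow> rhom (\<lambda>c. k (h c))"
  by (simp add: rhom_def)

lemma rhom_bev: "rhom h \<Longrightarrow> rhom (\<lambda>g. bev h g X Y)"
  unfolding bev_def
  by (intro rhom_comp[OF rhom_map_poly rhom_poly] rhom_comp[OF rhom_map_poly[of h] rhom_poly])

lemma rhoms [simp]:
  "rhom (\<lambda>c. c)" "rhom (\<lambda>c. [:c:])" "rhom fps_const" "rhom (of_int :: int \<Rightarrow> 'c::comm_ring_1)"
  "rhom (\<lambda>f. fps_nth f 0)"
  by (auto simp: rhom_def one_pCons mult.commute)

lemma rhom_cc [simp]: "rhom (\<lambda>c. [:[:c:]:])"
  by (rule rhom_comp[OF rhoms(2) rhoms(2)])

lemmas bev_hom = rhomD[OF rhom_bev]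

lemma bev_0 [simp]: "bev h 0 X Y = 0"
  by (simp add: bev_def)

lemma bev_pCons: "rhom h \<Longrightarrow> bev h (pCons a g) X Y = poly (map_poly h a) X + Y * bev h g X Y"
  using rhomD(1)[OF rhom_comp[OF rhom_map_poly[of h] rhom_poly[of X]]]
  by (simp add: bev_def map_poly_pCons)

lemma poly_map_pCons: "rhom h \<Longrightarrow> poly (map_poly h (pCons a g)) X = h a + X * poly (map_poly h g) X"
  by (simp add: map_poly_pCons rhomD)

lemma bev_vars [simp]:
  assumes "rhom h"
  shows "bev h xv X Y = X" "bev h yv X Y = Y" "bev h [:[:c:]:] X Y = h c"
  using assms by (simp_all add: bev_pCons poly_map_pCons rhomD)

text \<open>Constants and the two variables generate the polynomial ring, so identities between
  homomorphisms or derivations are checked on these generators.\<close>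

lemma bipoly_induct [case_names const x y add mult]:
  fixes g :: "'a::comm_ring_1 poly poly"
  assumes c: "\<And>c. R [:[:c:]:]" and x: "R xv" and y: "R yv"
    and add: "\<And>f g. R f \<Longrightarrow> R g \<Longrightarrow> R (f + g)" and mult: "\<And>f g. R f \<Longrightarrow> R g \<Longrightarrow> R (f * g)"
  shows "R g"
proof -
  have inner: "R [:p:]" for p :: "'a poly"
  proof (induction p)
    case 0 then show ?case using c[of 0] by simp
  next
    case (pCons a p)
    have "[:pCons a p:] = [:[:a:]:] + xv * [:p:]" by simp
    then show ?case using add mult c x pCons by metis
  qed
  show ?thesis
  proof (induction g)
    case 0 then show ?case using c[of 0] by simp
  next
    case (pCons a g)
    have "pCons a g = [:a:] + yv * g" by simp
    then show ?case using add mult inner y pCons by metis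
  qed
qed

text \<open>Both sides are ring homomorphisms in \<open>g\<close> that agree on constants and on the
  two variables.\<close>

lemma rhom_bev_commute:
  assumes "rhom h" "rhom k"
  shows "k (bev h g X Y) = bev (\<lambda>c. k (h c)) g (k X) (k Y)"
  by (induction g rule: bipoly_induct)
     (simp_all add: assms rhom_comp bev_hom rhomD)

lemma bcomp_id [simp]: "bcomp g xv yv = g"
  by (induction g rule: bipoly_induct) (simp_all add: bev_hom)

lemma bev_bcomp:
  assumes "rhom h"
  shows "bev h (bcomp g U V) X Y = bev h g (bev h U X Y) (bev h V X Y)"
  using rhom_bev_commute[OF rhom_cc rhom_bev[OF assms, of X Y], of g U V] assms by simp

section \<open>Partial derivatives, derivations, chain rule and Taylor formula\<close>

definition px :: "'a::idom poly poly \<Rightarrow> 'a poly poly" where "px = map_poly pderiv"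
abbreviation py :: "'a::idom poly poly \<Rightarrow> 'a poly poly" where "py \<equiv> pderiv"

definition derivation :: "('a::comm_ring_1 \<Rightarrow> 'a) \<Rightarrow> bool" where
  "derivation d \<longleftrightarrow> (\<forall>a b. d (a + b) = d a + d b) \<and> (\<forall>a b. d (a * b) = a * d b + d a * b)"

lemma derivationD:
  assumes "derivation d"
  shows "d (a + b) = d a + d b" "d (a * b) = a * d b + d a * b" "d 0 = 0" "d (- a) = - d a"
    "d (a - b) = d a - d b"
proof -
  show 1: "\<And>a b. d (a + b) = d a + d b" and "d (a * b) = a * d b + d a * b"
    using assms by (auto simp: derivation_def)
  show 0: "d 0 = 0" using 1[of 0 0] by simp
  have "d a + d (- a) = 0" for a using 1[of a "- a"] 0 by simp
  then show 3: "d (- a) = - d a" for a by (simp add: eq_neg_iff_add_eq_0 add.commute)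
  show "d (a - b) = d a - d b" using 1[of a "-b"] 3 by simp
qed

lemma coeff_px: "coeff (px g) i = pderiv (coeff g i)"
  by (simp add: px_def coeff_map_poly)

lemma px_pCons: "px (pCons a g) = pCons (pderiv a) (px g)"
  by (rule poly_eqI) (simp add: coeff_px coeff_pCons split: nat.split)

lemma px_0 [simp]: "px 0 = 0" by (simp add: px_def)

lemma derivation_py: "derivation py"
  by (simp add: derivation_def pderiv_add pderiv_mult mult.commute)

lemma derivation_px: "derivation px"
proof -
  have add: "px (a + b) = px a + px b" for a b :: "'a poly poly"
    by (rule poly_eqI) (simp add: coeff_px pderiv_add)
  have "px (a * b) = a * px b + px a * b" for a b :: "'a poly poly"
  proof (induction a)
    case (pCons c a)
    have "px (smult c b) = smult c (px b) + smult (pderiv c) b"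
      by (rule poly_eqI) (simp add: coeff_px pderiv_mult mult.commute)
    then show ?case using pCons
      by (simp add: mult_pCons_left px_pCons add algebra_simps)
  qed simp
  with add show ?thesis by (simp add: derivation_def)
qed

lemmas px_simps = derivationD[OF derivation_px]
lemmas py_simps = derivationD[OF derivation_py]

lemma pxy_vars [simp]: "px xv = 1" "px yv = 0" "px [:[:c:]:] = 0" "py xv = 0" "py yv = 1"
  "py [:[:c:]:] = 0" "px 1 = 0" "py (1::'a::idom poly poly) = 0"
  by (simp_all add: px_pCons pderiv_pCons one_pCons)

lemma px_py: "px (py g) = py (px g)"
  by (rule poly_eqI) (simp add: coeff_px coeff_pderiv pderiv_mult pderiv_of_nat del: of_nat_Suc)

text \<open>Formulated for any derivation killing the constants, so that one proof serves
  \<open>px\<close>, \<open>py\<close>, \<open>Dt\<close>, \<open>Du\<close> and differentiation in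
  a curve parameter.\<close>

lemma chain_rule:
  fixes g :: "'a::idom poly poly"
  assumes h: "rhom h" and d: "derivation d" and c: "\<And>c. d (h c) = 0"
  shows "d (bev h g X Y) = bev h (px g) X Y * d X + bev h (py g) X Y * d Y"
proof (induction g rule: bipoly_induct)
  case (mult f g)
  then show ?case
    by (simp add: bev_hom[OF h] px_simps py_simps derivationD[OF d]) (simp add: algebra_simps)
qed (simp_all add: h c bev_hom px_simps py_simps derivationD[OF d] algebra_simps)

text \<open>The remainder \<open>r\<close> is a ring element obtained without division. With
  \<open>e\<close> a power of the series variable, it affects only coefficients of at least twice
  that order.\<close>

lemma taylor_rule:
  fixes g :: "'a::idom poly poly"
  assumes h: "rhom h"
  shows "\<exists>r. bev h g (X + e * a) (Y + e * b)
    = bev h g X Y + e * (a * bev h (px g) X Y + b * bev h (py g) X Y) + e ^ 2 * r"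
proof (induction g rule: bipoly_induct)
  case (const c)
  then show ?case using h by (auto simp: intro!: exI[of _ 0])
next
  case x
  then show ?case using h by (auto simp: bev_hom intro!: exI[of _ 0])
next
  case y
  then show ?case using h by (auto simp: bev_hom intro!: exI[of _ 0])
next
  case (add f g)
  then obtain r s where "bev h f (X + e * a) (Y + e * b)
    = bev h f X Y + e * (a * bev h (px f) X Y + b * bev h (py f) X Y) + e ^ 2 * r"
    "bev h g (X + e * a) (Y + e * b)
    = bev h g X Y + e * (a * bev h (px g) X Y + b * bev h (py g) X Y) + e ^ 2 * s" by blast
  then show ?case
    by (intro exI[of _ "r + s"]) (simp add: bev_hom[OF h] px_simps py_simps algebra_simps)
next
  case (mult f g)
  let ?f = "bev h f X Y" and ?g = "bev h g X Y"
  let ?f' = "a * bev h (px f) X Y + b * bev h (py f) X Y"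
  let ?g' = "a * bev h (px g) X Y + b * bev h (py g) X Y"
  from mult obtain r s where r: "bev h f (X + e * a) (Y + e * b) = ?f + e * ?f' + e ^ 2 * r"
    and s: "bev h g (X + e * a) (Y + e * b) = ?g + e * ?g' + e ^ 2 * s" by blast
  have d: "a * bev h (px (f * g)) X Y + b * bev h (py (f * g)) X Y = ?f * ?g' + ?f' * ?g"
    by (simp add: bev_hom[OF h] px_simps py_simps algebra_simps)
  have "(?f + e * ?f' + e ^ 2 * r) * (?g + e * ?g' + e ^ 2 * s)
      = ?f * ?g + e * (?f * ?g' + ?f' * ?g)
        + e ^ 2 * (?f' * ?g' + r * ?g + ?f * s + e * (?f' * s + r * ?g') + e ^ 2 * (r * s))"
    by (simp add: algebra_simps power2_eq_square)
  then show ?case unfolding bev_hom(4)[OF h] r s d by blast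
qed

section \<open>The derivations of a Jacobian pair\<close>

locale keller =
  fixes P Q :: "'a::{idom, ring_char_0} poly poly"
  assumes jac: "px P * py Q - py P * px Q = 1"
begin

text \<open>\<open>Dt\<close> and \<open>Du\<close> are \<open>\<partial>/\<partial>t\<close> and \<open>\<partial>/\<partial>u\<close> in the coordinates \<open>u = P\<close>, \<open>t = Q\<close>.\<close>

definition Dt :: "'a poly poly \<Rightarrow> 'a poly poly" where
  "Dt g = px P * py g - py P * px g"

definition Du :: "'a poly poly \<Rightarrow> 'a poly poly" where
  "Du g = px g * py Q - py g * px Q"

lemma derivation_Dt: "derivation Dt"
  by (simp add: derivation_def Dt_def px_simps py_simps algebra_simps)

lemma derivation_Du: "derivation Du"
  by (simp add: derivation_def Du_def px_simps py_simps algebra_simps)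

lemmas Dt_simps = derivationD[OF derivation_Dt]
lemmas Du_simps = derivationD[OF derivation_Du]

lemma D_vals [simp]: "Dt P = 0" "Dt Q = 1" "Du P = 1" "Du Q = 0" "Dt [:[:c:]:] = 0" "Du [:[:c:]:] = 0"
  "Dt 1 = 0" "Du 1 = 0"
  using jac by (simp_all add: Dt_def Du_def mult.commute)

text \<open>Cramer's rule for the system defining \<open>Dt\<close> and \<open>Du\<close>, whose
  determinant is the Jacobian.\<close>

lemma px_eq: "px g = px P * Du g + px Q * Dt g"
  and py_eq: "py g = py P * Du g + py Q * Dt g"
proof -
  have "px P * Du g + px Q * Dt g = (px P * py Q - py P * px Q) * px g"
    by (simp add: Dt_def Du_def algebra_simps)
  then show "px g = px P * Du g + px Q * Dt g" using jac by simp
  have "py P * Du g + py Q * Dt g = (px P * py Q - py P * px Q) * py g"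
    by (simp add: Dt_def Du_def algebra_simps)
  then show "py g = py P * Du g + py Q * Dt g" using jac by simp
qed

lemma Dt_bcomp: "Dt (bcomp G P Q) = bcomp (py G) P Q"
  and Du_bcomp: "Du (bcomp G P Q) = bcomp (px G) P Q"
  by (simp_all add: chain_rule[OF rhom_cc derivation_Dt] chain_rule[OF rhom_cc derivation_Du])

lemma P_nonzero: "P \<noteq> 0"
  using jac by auto

text \<open>Algebraic independence of \<open>P\<close> and \<open>Q\<close>: applying
  \<open>Dt\<close> or \<open>Du\<close> to a relation differentiates it, so induction on the degree
  leaves only constant relations.\<close>

lemma bcomp_eq_0_iff: "bcomp G P Q = 0 \<longleftrightarrow> G = 0"
proof
  have c: "c = 0" if "bcomp [:c:] P Q = 0" for c :: "'a poly"
    using that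
  proof (induction "degree c" arbitrary: c rule: less_induct)
    case less
    have "bcomp [:pderiv c:] P Q = 0"
      using Du_bcomp[of "[:c:]"] less.prems by (simp add: px_pCons Du_simps)
    then have "pderiv c = 0" if "degree c \<noteq> 0"
      using less.hyps[of "pderiv c"] that by (simp add: degree_pderiv)
    then have "degree c = 0" by (metis pderiv_eq_0_iff)
    then obtain k where "c = [:k:]" by (metis degree_eq_zeroE)
    then show ?case using less.prems by simp
  qed
  show "G = 0" if "bcomp G P Q = 0"
    using that
  proof (induction "degree G" arbitrary: G rule: less_induct)
    case less
    have "bcomp (py G) P Q = 0"
      using Dt_bcomp[of G] less.prems by (simp add: Dt_simps)
    then have "py G = 0" if "degree G \<noteq> 0"
      using less.hyps[of "py G"] that by (simp add: degree_pderiv)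
    then have "degree G = 0" by (metis pderiv_eq_0_iff)
    then obtain k where "G = [:k:]" by (metis degree_eq_zeroE)
    then show ?case using less.prems c by simp
  qed
qed simp

end

text \<open>Stated for coefficient rings where positive integers are units, which covers both C and
  C[x].\<close>

lemma pderiv_surj:
  fixes p :: "'a::{idom, ring_char_0} poly"
  assumes "\<And>n. \<exists>u. of_nat (Suc n) * u = (1::'a)"
  shows "\<exists>q. pderiv q = p"
proof -
  obtain u where u: "\<And>n. of_nat (Suc n) * u n = (1::'a)" using assms by metis
  have sum: "pderiv (\<Sum>i\<in>A. f i) = (\<Sum>i\<in>A. pderiv (f i))" for A :: "nat set" and f :: "nat \<Rightarrow> 'a poly"
    by (induction A rule: infinite_finite_induct) (simp_all add: pderiv_add)
  have "pderiv (\<Sum>i\<le>degree p. monom (u i * coeff p i) (Suc i)) = (\<Sum>i\<le>degree p. monom (coeff p i) i)"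
    using u by (simp add: sum pderiv_monom mult.assoc[symmetric] del: of_nat_Suc)
  then show ?thesis using poly_as_sum_of_monoms[of p] by metis
qed

lemma pderiv_surj_complex: "\<exists>q. pderiv q = (p::complex poly)"
  by (rule pderiv_surj) (metis nonzero_mult_div_cancel_left of_nat_neq_0 times_divide_eq_right mult.right_neutral)

lemma py_surj: "\<exists>q. py q = (p::complex poly poly)"
proof (rule pderiv_surj)
  fix n
  have "of_nat (Suc n) * [:1 / of_nat (Suc n):] = (1 :: complex poly)"
    by (simp add: of_nat_poly one_pCons del: of_nat_Suc)
  then show "\<exists>u. of_nat (Suc n) * u = (1 :: complex poly)" by blast
qed

locale ckeller = keller P Q for P Q :: "complex poly poly"
begin

text \<open>If \<open>Dt f = 0\<close>, then \<open>df = Du f dP\<close>, and \<open>Du f\<close> again lies in the kernel but has smaller degree in \<open>y\<close>.\<close>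

lemma ker_Dt: "Dt f = 0 \<Longrightarrow> \<exists>c. f = bcomp [:c:] P Q"
proof (induction "degree f" arbitrary: f rule: less_induct)
  case less
  let ?g = "Du f"
  have fx: "px f = px P * ?g" and fy: "py f = py P * ?g"
    using px_eq[of f] py_eq[of f] less.prems by simp_all
  \<comment> \<open>Equality of the mixed derivatives says exactly that \<open>Dt\<close> kills
    \<open>Du f\<close>.\<close>
  have "px (py f) = py (px f)" by (rule px_py)
  then have Dg: "Dt ?g = 0" unfolding fx fy
    by (simp add: px_simps py_simps Dt_def px_py algebra_simps)
  \<comment> \<open>If \<open>Du f\<close> is c(P), subtracting q(P) with q' = c leaves a polynomial
    with both partial derivatives zero.\<close>
  have prim: ?case if "?g = bcomp [:c:] P Q" for c
  proof -
    obtain q where q: "pderiv q = c" using pderiv_surj_complex by blast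
    define r where "r = f - bcomp [:q:] P Q"
    have "Dt r = 0" "Du r = 0"
      using less.prems that q by (simp_all add: r_def Dt_simps Du_simps Dt_bcomp Du_bcomp px_pCons)
    then have "px r = 0" "py r = 0" using px_eq[of r] py_eq[of r] by simp_all
    then obtain s where s: "r = [:s:]" "pderiv s = 0"
      by (metis degree_eq_zeroE pderiv_eq_0_iff px_pCons pCons_eq_0_iff px_0)
    then obtain k where "s = [:k:]" by (metis degree_eq_zeroE pderiv_eq_0_iff)
    then have "f = bcomp ([:q:] + [:[:k:]:]) P Q" unfolding bev_hom(3)[OF rhom_cc]
      using s by (simp add: r_def algebra_simps)
    then show ?thesis by auto
  qed
  show ?case
  proof (cases "py P = 0")
    \<comment> \<open>The degree comparison in y breaks down here. But \<open>P\<close> depends on x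
      alone, the Jacobian condition makes it affine in x, and \<open>f\<close>, a polynomial in x,
      is one in \<open>P\<close>.\<close>
    case True
    then obtain p where p: "P = [:p:]" by (metis degree_eq_zeroE pderiv_eq_0_iff)
    with jac True have "[:pderiv p:] * py Q = 1" by (simp add: px_pCons)
    then have "coeff ([:pderiv p:] * py Q) 0 = 1" by simp
    then have "pderiv p * coeff (py Q) 0 = 1" by simp
    then have "degree (pderiv p) = 0" "pderiv p \<noteq> 0"
      by (metis degree_mult_eq_0 degree_1 mult_zero_left mult_zero_right one_neq_zero, auto)
    then obtain k where k: "pderiv p = [:k:]" "k \<noteq> 0" by (metis degree_eq_zeroE pCons_0_0)
    from fy True have "py f = 0" by simp
    then obtain c where c: "f = [:c:]" by (metis degree_eq_zeroE pderiv_eq_0_iff)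
    have "pderiv (p - [:0, k:]) = 0" using k by (simp add: pderiv_diff pderiv_pCons)
    then obtain l where l: "p - [:0, k:] = [:l:]" by (metis degree_eq_zeroE pderiv_eq_0_iff)
    then have pl: "p = [:l, k:]" by (simp add: algebra_simps)
    have "pcompose [: - l / k, 1 / k:] p = [:0, 1:]"
      using k(2) by (simp add: pl pcompose_pCons)
    have cc: "bcomp [:q:] P Q = [:pcompose q p:]" for q
    proof (induction q)
      case (pCons a q)
      have "bcomp [:pCons a q:] P Q = [:[:a:]:] + P * bcomp [:q:] P Q"
        by (simp add: bev_pCons poly_map_pCons)
      then show ?case using pCons by (simp add: p pcompose_pCons)
    qed simp
    have "f = bcomp [:pcompose c [: - l / k, 1 / k:]:] P Q"
      unfolding cc c pcompose_assoc[symmetric]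
      using k(2) by (simp add: pl pcompose_pCons)
    then show ?thesis by blast
  next
    case False
    show ?thesis
    proof (cases "?g = 0")
      case True
      then show ?thesis using prim[of 0] by simp
    next
      case g: False
      then have "py f \<noteq> 0" using False fy by simp
      then have "degree f \<noteq> 0" by (metis pderiv_eq_0_iff)
      moreover have "degree f - 1 = degree (py P) + degree ?g"
        using fy degree_pderiv[of f] degree_mult_eq[OF False g] by simp
      ultimately have "degree ?g < degree f" by linarith
      from less.hyps[OF this Dg] show ?thesis using prim by blast
    qed
  qed
qed

text \<open>Integrate step by step: if \<open>Dt f\<close> is G(P, Q) and \<open>py H = G\<close>,
  then f - H(P, Q) lies in the kernel and is a polynomial in \<open>P\<close>.\<close>

lemma Dt_nilpotent: "(Dt ^^ n) f = 0 \<Longrightarrow> \<exists>G. bcomp G P Q = f"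
proof (induction n arbitrary: f)
  case 0
  then show ?case by (intro exI[of _ 0]) simp
next
  case (Suc n)
  then have "(Dt ^^ n) (Dt f) = 0" by (simp add: funpow_swap1)
  from Suc.IH[OF this] obtain G where G: "bcomp G P Q = Dt f" by blast
  obtain H where H: "py H = G" using py_surj by blast
  have "Dt (f - bcomp H P Q) = 0" using G H by (simp add: Dt_simps Dt_bcomp)
  from ker_Dt[OF this] obtain c where "f - bcomp H P Q = bcomp [:c:] P Q" by blast
  then have "bcomp (H + [:c:]) P Q = f" by (simp add: bev_hom algebra_simps)
  then show ?case by blast
qed

end

section \<open>Local nilpotency from a polynomial section\<close>

lemma coeff_pderiv_mult_top:
  fixes p q :: "'a::{idom, ring_char_0} poly"
  assumes "degree p + degree q = Suc e"
  shows "coeff (pderiv p * q) e = of_nat (degree p) * (lead_coeff p * lead_coeff q)"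
proof (cases "degree p = 0")
  case True
  then have "pderiv p = 0" by (simp add: pderiv_eq_0_iff)
  then show ?thesis using True by simp
next
  case False
  then have "e = degree (pderiv p) + degree q" using assms by (simp add: degree_pderiv)
  then have "coeff (pderiv p * q) e = lead_coeff (pderiv p) * lead_coeff q"
    by (simp only: coeff_mult_degree_sum)
  then show ?thesis using False by (simp add: degree_pderiv coeff_pderiv)
qed

lemma coeff_pderiv_mult_above:
  fixes p q :: "'a::{idom, ring_char_0} poly"
  assumes "degree p + degree q < Suc e"
  shows "coeff (pderiv p * q) e = 0"
proof (cases "degree p = 0")
  case True
  then have "pderiv p = 0" by (simp add: pderiv_eq_0_iff)
  then show ?thesis by simp
next
  case False
  then have "degree (pderiv p * q) < e"
    using assms degree_mult_le[of "pderiv p" q] by (simp add: degree_pderiv)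
  then show ?thesis by (rule coeff_eq_0)
qed

text \<open>Let \<open>\<kappa>\<close> be the largest slope of an edge. If \<open>\<kappa> > d\<close>, the product of the edge monomials of \<open>p\<close> and \<open>q\<close> of
  highest degree in the outer variable survives in the Jacobian, which is constant in that variable.\<close>

lemma newton_edge:
  fixes p q :: "complex poly poly"
  assumes p0: "coeff p 0 = 0" and q0: "coeff q 0 = [:0, 1:]"
    and jac: "px p * py q - py p * px q = [:\<delta>:]" and \<delta>: "\<delta> \<noteq> 0"
  defines "d \<equiv> degree \<delta>"
  shows "(\<forall>i. coeff p i \<noteq> 0 \<longrightarrow> degree (coeff p i) \<le> d * i) \<and>
         (\<forall>i. coeff q i \<noteq> 0 \<longrightarrow> degree (coeff q i) \<le> 1 + d * i)"
proof (rule ccontr)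
  assume neg: "\<not> ?thesis"
  \<comment> \<open>Comparing terms free of the outer variable identifies the linear coefficient of
    \<open>p\<close>, which has degree \<open>d\<close>.\<close>
  have "coeff (px p * py q - py p * px q) 0 = \<delta>" unfolding jac by simp
  then have p1: "coeff p 1 = - \<delta>"
    by (simp add: coeff_mult coeff_px coeff_pderiv p0 q0 pderiv_pCons) (metis add.inverse_inverse)
  define A where "A = {i. i \<ge> 2 \<and> coeff p i \<noteq> 0}"
  define B where "B = {i. i \<ge> 1 \<and> coeff q i \<noteq> 0}"
  \<comment> \<open>Slopes of the segments to the exponent points from the base points (1, d) of
    \<open>p\<close> and (0, 1) of \<open>q\<close>.\<close>
  define sp where "sp i = (real (degree (coeff p i)) - d) / (real i - 1)" for i
  define sq where "sq i = (real (degree (coeff q i)) - 1) / real i" for i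
  define S where "S = sp ` A \<union> sq ` B"
  define \<kappa> where "\<kappa> = Max S"
  have "finite A" by (rule finite_subset[of _ "{..degree p}"]) (auto simp: A_def le_degree)
  moreover have "finite B" by (rule finite_subset[of _ "{..degree q}"]) (auto simp: B_def le_degree)
  ultimately have fS: "finite S" by (simp add: S_def)
  \<comment> \<open>The claimed bounds are the lines of slope \<open>d\<close> through the base
    points, so a violation gives a larger slope.\<close>
  have "\<exists>s\<in>S. s > d"
  proof -
    from neg consider i where "coeff p i \<noteq> 0" "degree (coeff p i) > d * i"
      | i where "coeff q i \<noteq> 0" "degree (coeff q i) > 1 + d * i" by (auto simp: not_le)
    then show ?thesis
    proof cases
      case 1
      have "i \<noteq> 0" using 1(1) p0 by metis
      moreover have "i \<noteq> 1" using 1 p1 by (auto simp: d_def)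
      ultimately have i: "i \<ge> 2" by simp
      have "real (degree (coeff p i)) > real (d * i)" using 1 by linarith
      then have "sp i > d" using i by (simp add: sp_def field_simps)
      then show ?thesis using i 1 by (auto simp: S_def A_def)
    next
      case 2
      have i: "i \<ge> 1" using 2 q0 by (cases "i = 0") auto
      have "real (degree (coeff q i)) > real (1 + d * i)" using 2 by linarith
      then have "sq i > d" using i by (simp add: sq_def field_simps)
      then show ?thesis using i 2 by (auto simp: S_def B_def)
    qed
  qed
  then have \<kappa>d: "\<kappa> > d" and Sne: "S \<noteq> {}" unfolding \<kappa>_def using Max_ge[OF fS] by force+
  have pb: "i \<ge> 1 \<and> degree (coeff p i) \<le> d + \<kappa> * (real i - 1)" if "coeff p i \<noteq> 0" for i
  proof -
    have "i \<noteq> 0" using that p0 by metis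
    moreover have ?thesis if "i = 1" using that p1 by (simp add: d_def)
    moreover have ?thesis if "i \<ge> 2"
    proof -
      have "sp i \<le> \<kappa>" unfolding \<kappa>_def using fS that \<open>coeff p i \<noteq> 0\<close> by (auto simp: S_def A_def)
      then show ?thesis using that by (simp add: sp_def field_simps)
    qed
    ultimately show ?thesis by linarith
  qed
  have qb: "degree (coeff q i) \<le> 1 + \<kappa> * i" if "coeff q i \<noteq> 0" for i
  proof (cases "i = 0")
    case True
    then show ?thesis by (simp add: q0)
  next
    case False
    have "sq i \<le> \<kappa>" unfolding \<kappa>_def using fS False that by (auto simp: S_def B_def)
    then show ?thesis using False by (simp add: sq_def field_simps)
  qed
  \<comment> \<open>Indices on the edges of slope \<open>\<kappa>\<close>, including the base
    points; \<open>I\<close> and \<open>K\<close> are the last ones.\<close>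
  define EP where "EP = {i. coeff p i \<noteq> 0 \<and> degree (coeff p i) = d + \<kappa> * (real i - 1)}"
  define EQ where "EQ = {i. coeff q i \<noteq> 0 \<and> degree (coeff q i) = 1 + \<kappa> * i}"
  have fE: "finite EP" "finite EQ"
    by (rule finite_subset[of _ "{..degree p}"], auto simp: EP_def le_degree)
       (rule finite_subset[of _ "{..degree q}"], auto simp: EQ_def le_degree)
  have "1 \<in> EP" using p1 \<delta> by (simp add: EP_def d_def)
  have "0 \<in> EQ" using q0 by (simp add: EQ_def)
  define I where "I = Max EP"
  define K where "K = Max EQ"
  have I: "I \<in> EP" and K: "K \<in> EQ" and I1: "I \<ge> 1"
    unfolding I_def K_def using fE \<open>1 \<in> EP\<close> \<open>0 \<in> EQ\<close> by (auto intro: Max_in Max_ge)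
  \<comment> \<open>The maximal slope is attained beyond a base point. So \<open>n = I + K\<close>
    exceeds 1, where the Jacobian times the outer variable has no term.\<close>
  have IK: "I + K \<ge> 2"
  proof -
    have "\<kappa> \<in> S" unfolding \<kappa>_def using fS Sne by (rule Max_in)
    then consider i where "i \<in> A" "\<kappa> = sp i" | i where "i \<in> B" "\<kappa> = sq i" by (auto simp: S_def)
    then show ?thesis
    proof cases
      case 1
      then have "i \<in> EP" "i \<ge> 2" by (auto simp: A_def EP_def sp_def)
      then have "I \<ge> i" unfolding I_def using fE by simp
      then show ?thesis using \<open>i \<ge> 2\<close> by linarith
    next
      case 2
      then have "i \<in> EQ" "i \<ge> 1" by (auto simp: B_def EQ_def sq_def)
      then have "K \<ge> i" unfolding K_def using fE by simp
      then show ?thesis using \<open>i \<ge> 1\<close> I1 by linarith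
    qed
  qed
  define n where "n = I + K"
  define J where "J = degree (coeff p I)"
  define L where "L = degree (coeff q K)"
  have J: "real J = d + \<kappa> * (real I - 1)" and L: "real L = 1 + \<kappa> * K"
    using I K by (auto simp: EP_def EQ_def J_def L_def)
  have "real L \<ge> 1" unfolding L using \<kappa>d by simp
  then have L1: "L \<ge> 1" by simp
  define e where "e = J + L - 1"
  have e: "J + L = Suc e" using L1 by (simp add: e_def)
  \<comment> \<open>Multiplication by the outer variable turns \<open>py\<close> into the Euler
    operator and avoids an index shift.\<close>
  have \<theta>: "coeff (yv * py f) i = of_nat i * coeff f i" for f :: "complex poly poly" and i
    by (cases i) (simp_all add: coeff_pderiv coeff_pCons del: of_nat_Suc)
  have "yv * (px p * py q - py p * px q) = [:0, \<delta>:]" unfolding jac by simp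
  then have "px p * (yv * py q) - (yv * py p) * px q = [:0, \<delta>:]" by (simp add: algebra_simps)
  then have "coeff (px p * (yv * py q) - (yv * py p) * px q) n = 0"
    using IK by (simp add: n_def coeff_pCons split: nat.split)
  then have s0: "(\<Sum>i\<le>n. pderiv (coeff p i) * (of_nat (n - i) * coeff q (n - i))
      - of_nat i * coeff p i * pderiv (coeff q (n - i))) = 0"
    unfolding coeff_diff coeff_mult[of _ _ n] \<theta> coeff_px by (simp only: sum_subtractf)
  define T where "T i = of_nat (n - i) * coeff (pderiv (coeff p i) * coeff q (n - i)) e
      - of_nat i * coeff (pderiv (coeff q (n - i)) * coeff p i) e" for i
  have cn: "coeff (of_nat k * f) e = of_nat k * coeff f e" for k and f :: "complex poly"
    by (simp add: of_nat_poly)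
  have "coeff (\<Sum>i\<le>n. pderiv (coeff p i) * (of_nat (n - i) * coeff q (n - i))
      - of_nat i * coeff p i * pderiv (coeff q (n - i))) e = (\<Sum>i\<le>n. T i)"
    unfolding coeff_sum T_def cn[symmetric] coeff_diff[symmetric]
    by (intro sum.cong refl arg_cong[of _ _ "\<lambda>f. coeff f e"]) (simp add: algebra_simps)
  then have T0: "(\<Sum>i\<le>n. T i) = 0" using s0 by simp
  \<comment> \<open>In degree \<open>e\<close> only the pair of last edge points survives: in any
    other pair with index sum \<open>n\<close>, one point lies below its edge, and the degree sum
    drops.\<close>
  have "T i = 0" if "i \<le> n" "i \<noteq> I" for i
  proof (cases "coeff p i = 0 \<or> coeff q (n - i) = 0")
    case True
    then show ?thesis by (auto simp: T_def)
  next
    case False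
    define k where "k = n - i"
    have ik: "real i + real k = real I + real K" using that by (simp add: k_def n_def of_nat_diff)
    have a: "degree (coeff p i) \<le> d + \<kappa> * (real i - 1)" and b: "degree (coeff q k) \<le> 1 + \<kappa> * k"
      using pb[of i] qb[of k] False by (auto simp: k_def)
    have tot: "(d + \<kappa> * (real i - 1)) + (1 + \<kappa> * k) = real J + real L"
    proof -
      have "(d + \<kappa> * (real i - 1)) + (1 + \<kappa> * k) = d + 1 - \<kappa> + \<kappa> * (real i + real k)"
        by (simp add: algebra_simps)
      also have "\<dots> = real J + real L" unfolding ik J L by (simp add: algebra_simps)
      finally show ?thesis .
    qed
    have "\<not> (i \<in> EP \<and> k \<in> EQ)"
    proof
      assume "i \<in> EP \<and> k \<in> EQ"
      then have "i \<le> I" "k \<le> K" unfolding I_def K_def using fE by auto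
      then show False using ik that by linarith
    qed
    then have "degree (coeff p i) \<noteq> d + \<kappa> * (real i - 1) \<or> degree (coeff q k) \<noteq> 1 + \<kappa> * k"
      using False by (auto simp: EP_def EQ_def k_def)
    then have "real (degree (coeff p i)) + real (degree (coeff q k)) < real J + real L"
      using a b tot by linarith
    then have "degree (coeff p i) + degree (coeff q k) < Suc e" using e by linarith
    then show ?thesis
      unfolding T_def k_def[symmetric] by (simp add: coeff_pderiv_mult_above)
  qed
  then have "(\<Sum>i\<le>n. T i) = (\<Sum>i\<in>{I}. T i)"
    by (intro sum.mono_neutral_right) (auto simp: n_def)
  then have "T I = 0" using T0 by simp
  moreover have "T I = (of_nat (K * J) - of_nat (I * L)) * (lead_coeff (coeff p I) * lead_coeff (coeff q K))"
    unfolding T_def n_def using e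
    by (simp add: coeff_pderiv_mult_top J_def L_def add.commute) (simp add: algebra_simps)
  \<comment> \<open>The leading coefficients are nonzero, so \<open>K * J = I * L\<close>; the edge
    equations turn this into \<open>K * (\<kappa> - d) + I = 0\<close>.\<close>
  ultimately have "(of_nat (K * J) :: complex) = of_nat (I * L)"
    using I K by (auto simp: EP_def EQ_def)
  then have "real (K * J) = real (I * L)" using of_nat_eq_iff by metis
  then have "K * (d + \<kappa> * (real I - 1)) = I * (1 + \<kappa> * K)" by (simp add: J L)
  then have "K * (\<kappa> - d) + I = 0" by (simp add: algebra_simps)
  moreover have "K * (\<kappa> - d) \<ge> 0" using \<kappa>d by simp
  ultimately show False using I1 by linarith
qed

text \<open>The inner variable has weight 1, the outer one weight \<open>-d\<close>.\<close>

definition wle :: "nat \<Rightarrow> int \<Rightarrow> complex poly poly \<Rightarrow> bool" where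
  "wle d w g \<longleftrightarrow> (\<forall>i. coeff g i \<noteq> 0 \<longrightarrow> int (degree (coeff g i)) \<le> w + int (d * i))"

lemma wle_add:
  assumes "wle d w f" "wle d w g" shows "wle d w (f + g)"
  unfolding wle_def
proof safe
  fix i assume "coeff (f + g) i \<noteq> 0"
  then show "int (degree (coeff (f + g) i)) \<le> w + int (d * i)"
    using assms degree_add_le_max[of "coeff f i" "coeff g i"]
    by (cases "coeff f i = 0"; cases "coeff g i = 0") (fastforce simp: wle_def)+
qed

lemma wle_diff:
  assumes "wle d w f" "wle d w g" shows "wle d w (f - g)"
proof -
  have "wle d w (- g)" using assms(2) by (simp add: wle_def)
  then show ?thesis using wle_add[OF assms(1)] by fastforce
qed

lemma wle_mult:
  assumes "wle d v f" "wle d w g" shows "wle d (v + w) (f * g)"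
  unfolding wle_def
proof safe
  fix i assume "coeff (f * g) i \<noteq> 0"
  have "\<exists>n. int n \<le> v + w + int (d * i) \<and> degree (coeff (f * g) i) \<le> n"
  proof -
    have t: "coeff f j * coeff g (i - j) = 0 \<or>
        int (degree (coeff f j * coeff g (i - j))) \<le> v + w + int (d * i)" if "j \<le> i" for j
    proof (cases "coeff f j = 0 \<or> coeff g (i - j) = 0")
      case False
      then have "int (degree (coeff f j)) \<le> v + int (d * j)" "int (degree (coeff g (i - j))) \<le> w + int (d * (i - j))"
        using assms by (auto simp: wle_def)
      moreover have "d * j + d * (i - j) = d * i" using that by (simp flip: distrib_left)
      ultimately show ?thesis using False by (simp add: degree_mult_eq flip: of_nat_mult)
    qed auto
    define n where "n = nat (v + w + int (d * i))"
    have "v + w + int (d * i) \<ge> 0"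
    proof (rule ccontr)
      assume neg: "\<not> ?thesis"
      have "coeff f j * coeff g (i - j) = 0" if "j \<le> i" for j
        using t[OF that] neg by linarith
      then have "(\<Sum>j\<le>i. coeff f j * coeff g (i - j)) = 0" by (intro sum.neutral) auto
      then show False using \<open>coeff (f * g) i \<noteq> 0\<close> by (simp add: coeff_mult)
    qed
    then have "int n = v + w + int (d * i)" by (simp add: n_def)
    moreover have "degree (coeff (f * g) i) \<le> n"
      unfolding coeff_mult
    proof (rule degree_sum_le)
      fix j assume "j \<in> {..i}"
      then show "degree (coeff f j * coeff g (i - j)) \<le> n"
        using t[of j] \<open>int n = _\<close> by auto
    qed simp
    ultimately show ?thesis by (intro exI[of _ n]) simp
  qed
  then show "int (degree (coeff (f * g) i)) \<le> v + w + int (d * i)" by linarith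
qed

lemma wle_px: "wle d w g \<Longrightarrow> wle d (w - 1) (px g)"
  unfolding wle_def coeff_px
proof safe
  fix i assume a: "\<forall>i. coeff g i \<noteq> 0 \<longrightarrow> int (degree (coeff g i)) \<le> w + int (d * i)"
    and nz: "pderiv (coeff g i) \<noteq> 0"
  then have "degree (coeff g i) \<noteq> 0" by (simp add: pderiv_eq_0_iff)
  moreover have "coeff g i \<noteq> 0" using nz by auto
  with a have "int (degree (coeff g i)) \<le> w + int (d * i)" by blast
  ultimately show "int (degree (pderiv (coeff g i))) \<le> w - 1 + int (d * i)"
    by (simp add: degree_pderiv)
qed

lemma wle_py: "wle d w g \<Longrightarrow> wle d (w + int d) (py g)"
  unfolding wle_def
proof safe
  fix i assume a: "\<forall>i. coeff g i \<noteq> 0 \<longrightarrow> int (degree (coeff g i)) \<le> w + int (d * i)"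
    and nz: "coeff (py g) i \<noteq> 0"
  then have "coeff g (Suc i) \<noteq> 0" by (auto simp: coeff_pderiv)
  with a have "int (degree (coeff g (Suc i))) \<le> w + int (d * Suc i)" by blast
  moreover have "degree (coeff (py g) i) = degree (coeff g (Suc i))"
    by (simp add: coeff_pderiv of_nat_poly del: of_nat_Suc)
  ultimately show "int (degree (coeff (py g) i)) \<le> w + int d + int (d * i)" by simp
qed

text \<open>Multiplication by \<open>c\<close> raises the degree of every nonzero outer coefficient
  by exactly \<open>degree c\<close>.\<close>

lemma wle_cancel:
  assumes "wle (degree c) w ([:c:] * g)" "c \<noteq> 0"
  shows "wle (degree c) (w - int (degree c)) g"
  using assms unfolding wle_def by (auto simp: degree_mult_eq)

lemma wle_exists: "\<exists>w. wle d w g"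
proof -
  have "wle d (int (\<Sum>i\<le>degree g. degree (coeff g i))) g"
    unfolding wle_def
  proof safe
    fix i assume "coeff g i \<noteq> 0"
    then have "i \<in> {..degree g}" by (simp add: le_degree)
    then have "degree (coeff g i) \<le> (\<Sum>i\<le>degree g. degree (coeff g i))"
      by (intro member_le_sum) auto
    then show "int (degree (coeff g i)) \<le> int (\<Sum>i\<le>degree g. degree (coeff g i)) + int (d * i)" by linarith
  qed
  then show ?thesis ..
qed

lemma wle_mono: "wle d v g \<Longrightarrow> v \<le> w \<Longrightarrow> wle d w g"
  unfolding wle_def by force

text \<open>In characteristic zero, suitable repeated derivatives of a nonzero element would produce
  a nonzero constant in \<open>I\<close>.\<close>

lemma derivative_closed_trivial:
  fixes I :: "'a::{idom, ring_char_0} poly poly set"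
  assumes x: "\<And>g. g \<in> I \<Longrightarrow> px g \<in> I" and y: "\<And>g. g \<in> I \<Longrightarrow> py g \<in> I"
    and c: "\<And>k. [:[:k:]:] \<in> I \<Longrightarrow> k = 0" and "g \<in> I"
  shows "g = 0"
proof -
  have 1: "[:q:] \<in> I \<Longrightarrow> q = 0" for q
  proof (induction "degree q" arbitrary: q rule: less_induct)
    case less
    have "[:pderiv q:] \<in> I" using x[OF less.prems] by (simp add: px_pCons)
    then have "pderiv q = 0" if "degree q \<noteq> 0"
      using less.hyps[of "pderiv q"] that by (simp add: degree_pderiv)
    then have "degree q = 0" by (metis pderiv_eq_0_iff)
    then obtain k where "q = [:k:]" by (metis degree_eq_zeroE)
    then show ?case using less.prems c by simp
  qed
  show ?thesis using \<open>g \<in> I\<close>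
  proof (induction "degree g" arbitrary: g rule: less_induct)
    case less
    have "py g \<in> I" using y[OF less.prems] .
    then have "py g = 0" if "degree g \<noteq> 0"
      using less.hyps[of "py g"] that by (simp add: degree_pderiv)
    then have "degree g = 0" by (metis pderiv_eq_0_iff)
    then obtain k where "g = [:k:]" by (metis degree_eq_zeroE)
    then show ?case using less.prems 1 by simp
  qed
qed

section \<open>The ideal of negative weights and local nilpotency of \<open>Dt\<close>\<close>

inductive_set ideal_gen :: "'a::comm_ring_1 set \<Rightarrow> 'a set" for W where
  base: "g \<in> W \<Longrightarrow> f * g \<in> ideal_gen W"
| add: "f \<in> ideal_gen W \<Longrightarrow> g \<in> ideal_gen W \<Longrightarrow> f + g \<in> ideal_gen W"

text \<open>The curve (a, b) lies in \<open>P = 0\<close> and is parametrized by the value of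
  \<open>Q\<close>: a polynomial section over the line {0} x C.\<close>

locale keller_line = ckeller +
  fixes a b :: "complex poly"
  assumes Pab: "bev (\<lambda>c. [:c:]) P a b = 0" and Qab: "bev (\<lambda>c. [:c:]) Q a b = [:0, 1:]"
begin

text \<open>If every direction were tangent everywhere, \<open>a\<close> and \<open>b\<close> would
  be constant, and so would \<open>Q\<close> on the curve.\<close>

lemma direction: "\<exists>e1 e2. smult e2 (pderiv a) - smult e1 (pderiv b) \<noteq> 0"
proof (rule ccontr)
  assume "\<not> ?thesis"
  then have "smult e2 (pderiv a) - smult e1 (pderiv b) = 0" for e1 e2 by blast
  from this[of 0 1] this[of 1 0] have "pderiv a = 0" "pderiv b = 0" by simp_all
  moreover have "derivation (pderiv :: complex poly \<Rightarrow> _)"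
    by (simp add: derivation_def pderiv_add pderiv_mult mult.commute)
  ultimately have "pderiv (bev (\<lambda>c. [:c:]) Q a b) = 0"
    by (subst chain_rule[OF rhoms(2)]) auto
  then show False unfolding Qab by (simp add: pderiv_pCons)
qed

lemma Dt_locally_nilpotent: "\<exists>n. (Dt ^^ n) g = 0"
proof -
  from direction obtain e1 e2 where "smult e2 (pderiv a) - smult e1 (pderiv b) \<noteq> 0" by blast
  \<comment> \<open>\<open>\<delta>\<close> is the Jacobian of the substitution x = a + e1 l, y = b
    + e2 l performed by \<open>hat\<close>, with inner variable T and outer variable l.\<close>
  define \<delta> where "\<delta> = smult e2 (pderiv a) - smult e1 (pderiv b)"
  have \<delta>: "\<delta> \<noteq> 0" unfolding \<delta>_def by fact
  define d where "d = degree \<delta>"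
  define hat where "hat g = bcomp g [:a, [:e1:]:] [:b, [:e2:]:]" for g
  have hat0: "coeff (hat g) 0 = bev (\<lambda>c. [:c:]) g a b" for g
    using rhom_bev_commute[OF rhom_cc rhom_poly[of 0], of g "[:a, [:e1:]:]" "[:b, [:e2:]:]"]
    by (simp add: hat_def poly_0_coeff_0)
  have hx: "px (hat g) = hat (px g) * [:pderiv a:] + hat (py g) * [:pderiv b:]" for g
    unfolding hat_def by (subst chain_rule[OF rhom_cc derivation_px]) (simp_all add: px_pCons)
  have hy: "py (hat g) = hat (px g) * [:[:e1:]:] + hat (py g) * [:[:e2:]:]" for g
    unfolding hat_def by (subst chain_rule[OF rhom_cc derivation_py]) (simp_all add: pderiv_pCons)
  have hj: "px (hat f) * py (hat g) - py (hat f) * px (hat g)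
      = [:\<delta>:] * hat (px f * py g - py f * px g)" for f g
  proof -
    have "[:\<delta>:] = [:pderiv a:] * [:[:e2:]:] - [:[:e1:]:] * [:pderiv b:]" by (simp add: \<delta>_def)
    moreover have "hat (px f * py g - py f * px g) = hat (px f) * hat (py g) - hat (py f) * hat (px g)"
      by (simp add: hat_def bev_hom)
    ultimately show ?thesis unfolding hx hy by (simp only:) (simp only: algebra_simps)
  qed
  have "hat 1 = 1" by (simp add: hat_def bev_hom)
  have ne: "(\<forall>i. coeff (hat P) i \<noteq> 0 \<longrightarrow> degree (coeff (hat P) i) \<le> d * i) \<and>
         (\<forall>i. coeff (hat Q) i \<noteq> 0 \<longrightarrow> degree (coeff (hat Q) i) \<le> 1 + d * i)"
    unfolding d_def
    by (rule newton_edge) (simp_all add: hat0 Pab Qab hj jac \<open>hat 1 = 1\<close> \<delta>)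
  then have "int (degree (coeff (hat P) i)) \<le> int (d * i)" if "coeff (hat P) i \<noteq> 0" for i
    using ne[THEN conjunct1, rule_format, OF that] by (simp only: of_nat_le_iff)
  then have wP: "wle d 0 (hat P)" by (simp add: wle_def)
  have "int (degree (coeff (hat Q) i)) \<le> int (1 + d * i)" if "coeff (hat Q) i \<noteq> 0" for i
    using ne[THEN conjunct2, rule_format, OF that] by (simp only: of_nat_le_iff)
  then have wQ: "wle d 1 (hat Q)" by (simp add: wle_def)
  \<comment> \<open>\<open>P\<close> has weight at most 0, the two derivatives contribute
    \<open>d - 1\<close>, and cancelling \<open>\<delta>\<close> removes \<open>d\<close>: in total
    the weight drops by 1.\<close>
  have wDt: "wle d (w - 1) (hat (Dt g))" if "wle d w (hat g)" for w g
  proof -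
    have "wle d (0 - 1 + (w + int d)) (px (hat P) * py (hat g))"
      "wle d (0 + int d + (w - 1)) (py (hat P) * px (hat g))"
      by (intro wle_mult wle_px wle_py that wP)+
    then have "wle d (w - 1 + int d) ([:\<delta>:] * hat (Dt g))"
      unfolding Dt_def hj[symmetric] by (intro wle_diff) (simp_all add: algebra_simps)
    from wle_cancel[OF this[unfolded d_def] \<delta>] show ?thesis by (simp add: d_def)
  qed
  \<comment> \<open>The same count with \<open>Q\<close> of weight at most 1 leaves the weight
    unchanged.\<close>
  have wDu: "wle d w (hat (Du g))" if "wle d w (hat g)" for w g
  proof -
    have "wle d (w - 1 + (1 + int d)) (px (hat g) * py (hat Q))"
      "wle d (w + int d + (1 - 1)) (py (hat g) * px (hat Q))"
      by (intro wle_mult wle_px wle_py that wQ)+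
    then have "wle d (w + int d) ([:\<delta>:] * hat (Du g))"
      unfolding Du_def hj[symmetric] by (intro wle_diff) (simp_all add: algebra_simps)
    from wle_cancel[OF this[unfolded d_def] \<delta>] show ?thesis by (simp add: d_def)
  qed
  \<comment> \<open>Negative weight leaves no term free of l, so \<open>g\<close> vanishes on the
    curve.\<close>
  have van: "bev (\<lambda>c. [:c:]) g a b = 0" if "wle d (-1) (hat g)" for g
  proof -
    have "coeff (hat g) 0 = 0" using that[unfolded wle_def, rule_format, of 0] by auto
    then show ?thesis by (simp add: hat0)
  qed
  \<comment> \<open>\<open>px\<close> and \<open>py\<close> combine \<open>Dt\<close> and
    \<open>Du\<close> with polynomial coefficients that need not respect weights. The generated
    ideal is nevertheless closed under them; its members still vanish on the curve, so it contains
    no nonzero constant and is zero.\<close>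
  let ?W = "{g. wle d (-1) (hat g)}"
  let ?I = "ideal_gen ?W"
  have Ider: "D h \<in> ?I" if D: "derivation D" "\<And>g. g \<in> ?W \<Longrightarrow> D g \<in> ?W" and "h \<in> ?I" for D h
    using \<open>h \<in> ?I\<close>
  proof (induction rule: ideal_gen.induct)
    case (base g f)
    then show ?case using D ideal_gen.intros by (metis derivationD(2))
  next
    case (add f g)
    then show ?case using D ideal_gen.intros by (metis derivationD(1))
  qed
  have IDt: "Dt h \<in> ?I" if "h \<in> ?I" for h
  proof (rule Ider[OF derivation_Dt _ that])
    show "Dt g \<in> ?W" if "g \<in> ?W" for g
      using wle_mono[OF wDt[of "-1" g], of "-1"] that by simp
  qed
  have IDu: "Du h \<in> ?I" if "h \<in> ?I" for h
    using Ider[OF derivation_Du _ that] wDu[of "-1"] by auto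
  have Imult: "f * h \<in> ?I" if "h \<in> ?I" for f h
    using that
    by (induction rule: ideal_gen.induct) (auto intro: ideal_gen.intros simp: distrib_left mult.assoc[symmetric])
  have Ivan: "bev (\<lambda>c. [:c:]) h a b = 0" if "h \<in> ?I" for h
    using that by (induction rule: ideal_gen.induct) (auto simp: bev_hom van)
  have I0: "h = 0" if "h \<in> ?I" for h
  proof (rule derivative_closed_trivial[OF _ _ _ that])
    show "px g \<in> ?I" "py g \<in> ?I" if "g \<in> ?I" for g
      unfolding px_eq[of g] py_eq[of g] using that by (auto intro: ideal_gen.add Imult IDt IDu)
    show "k = 0" if "[:[:k:]:] \<in> ?I" for k
      using Ivan[OF that] by simp
  qed
  have W0: "h = 0" if "wle d (-1) (hat h)" for h
    using I0 ideal_gen.base[of h ?W 1] that by simp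
  obtain w where w: "wle d w (hat g)" using wle_exists by blast
  have "wle d (w - int n) (hat ((Dt ^^ n) g))" for n
    by (induction n) (use w wDt in \<open>force simp: algebra_simps\<close>)+
  from this[of "nat (w + 1)"] have "wle d (-1) (hat ((Dt ^^ nat (w + 1)) g))"
    by (rule wle_mono) linarith
  then show ?thesis using W0 by blast
qed

end

section \<open>The flow as a formal power series\<close>

definition coeffs_in :: "'a::zero set \<Rightarrow> 'a poly poly \<Rightarrow> bool" where
  "coeffs_in S g \<longleftrightarrow> (\<forall>i j. coeff (coeff g i) j \<in> S)"

definition subring_of :: "'a::comm_ring_1 set \<Rightarrow> bool" where
  "subring_of S \<longleftrightarrow> 0 \<in> S \<and> 1 \<in> S \<and> (\<forall>a\<in>S. \<forall>b\<in>S. a + b \<in> S \<and> a - b \<in> S \<and> a * b \<in> S)"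

lemma subringD:
  assumes "subring_of S"
  shows "0 \<in> S" "1 \<in> S" "a \<in> S \<Longrightarrow> b \<in> S \<Longrightarrow> a + b \<in> S" "a \<in> S \<Longrightarrow> b \<in> S \<Longrightarrow> a - b \<in> S"
    "a \<in> S \<Longrightarrow> b \<in> S \<Longrightarrow> a * b \<in> S"
  using assms by (auto simp: subring_of_def)

lemma subring_sum: "subring_of S \<Longrightarrow> (\<And>i. i \<in> A \<Longrightarrow> f i \<in> S) \<Longrightarrow> sum f A \<in> S"
  by (induction A rule: infinite_finite_induct) (auto simp: subringD)

lemma subring_of_nat: "subring_of S \<Longrightarrow> of_nat n \<in> S"
  by (induction n) (auto simp: subringD)

lemma subring_coeffs_in:
  assumes S: "subring_of S"
  shows "subring_of {g. coeffs_in S g}"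
proof -
  have "coeff (coeff (f * g) i) j \<in> S" if "coeffs_in S f" "coeffs_in S g" for f g i j
    using that unfolding coeff_mult coeff_sum coeffs_in_def
    by (intro subring_sum[OF S] subringD(5)[OF S]) auto
  moreover have "coeff (coeff 1 i) j \<in> S" for i j
    using subringD(1,2)[OF S] by (simp add: coeff_1)
  ultimately show ?thesis
    unfolding subring_of_def[of "{g. coeffs_in S g}"] using subringD(1,3,4)[OF S]
    by (simp add: coeffs_in_def)
qed

lemma subring_power: "subring_of S \<Longrightarrow> a \<in> S \<Longrightarrow> a ^ n \<in> S"
  by (induction n) (simp_all add: subringD)

lemma subring_fps: "subring_of S \<Longrightarrow> subring_of {f. \<forall>n. fps_nth f n \<in> S}"
  unfolding subring_of_def[of "{f. \<forall>n. fps_nth f n \<in> S}"]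
  by (auto simp: subringD fps_mult_nth intro!: subring_sum)

lemma bev_in_subring:
  assumes h: "rhom h" and T: "subring_of T" and S: "\<And>c. c \<in> S \<Longrightarrow> h c \<in> T"
    and g: "coeffs_in S g" and X: "X \<in> T" and Y: "Y \<in> T"
  shows "bev h g X Y \<in> T"
proof -
  have 1: "poly (map_poly h p) X \<in> T" if "\<And>j. coeff p j \<in> S" for p
    using that
  proof (induction p)
    case 0 then show ?case using T by (simp add: subringD)
  next
    case (pCons a p)
    have "a \<in> S" using pCons(3)[of 0] by simp
    moreover have "coeff p j \<in> S" for j using pCons(3)[of "Suc j"] by simp
    ultimately show ?case using pCons(2) S X by (simp add: poly_map_pCons h subringD[OF T])
  qed
  show ?thesis using g
  proof (induction g)
    case 0 then show ?case using T by (simp add: subringD)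
  next
    case (pCons a g)
    have "coeff a j \<in> S" for j using pCons(3) unfolding coeffs_in_def by (metis coeff_pCons_0)
    moreover have "coeffs_in S g" using pCons(3) unfolding coeffs_in_def by (metis coeff_pCons_Suc)
    ultimately show ?case using pCons(2) 1[of a] Y by (simp add: bev_pCons h subringD[OF T])
  qed
qed

lemma coeffs_in_px: "subring_of S \<Longrightarrow> coeffs_in S g \<Longrightarrow> coeffs_in S (px g)"
  unfolding coeffs_in_def coeff_px coeff_pderiv by (auto intro: subringD subring_of_nat)

lemma coeffs_in_py: "subring_of S \<Longrightarrow> coeffs_in S g \<Longrightarrow> coeffs_in S (py g)"
  unfolding coeffs_in_def coeff_pderiv of_nat_poly
  by (auto intro: subringD subring_of_nat)

lemma fps_nth_bev: "fps_nth (bev fps_const g X Y) 0 = beval g (fps_nth X 0) (fps_nth Y 0)"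
  using rhom_bev_commute[OF rhoms(3) rhoms(5), of g X Y] by simp

context ckeller
begin

text \<open>The Taylor series of \<open>g\<close> along the integral curve of \<open>Dt\<close>
  through (x0, y0), that is exp(s Dt) g evaluated there.\<close>

definition flow :: "complex \<Rightarrow> complex \<Rightarrow> complex poly poly \<Rightarrow> complex fps" where
  "flow x0 y0 g = Abs_fps (\<lambda>k. beval ((Dt ^^ k) g) x0 y0 / fact k)"

lemma flow_0: "fps_nth (flow x0 y0 g) 0 = beval g x0 y0"
  by (simp add: flow_def)

lemma fps_deriv_flow: "fps_deriv (flow x0 y0 g) = flow x0 y0 (Dt g)"
  by (rule fps_ext) (simp add: flow_def funpow_swap1 field_simps del: of_nat_Suc)

lemma flow_add: "flow x0 y0 (f + g) = flow x0 y0 f + flow x0 y0 g"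
proof -
  have "(Dt ^^ k) (f + g) = (Dt ^^ k) f + (Dt ^^ k) g" for k
    by (induction k) (simp_all add: Dt_simps)
  then show ?thesis by (intro fps_ext) (simp add: flow_def bev_hom add_divide_distrib)
qed

text \<open>Both sides obey the same product rule under differentiation, which passes from
  coefficient \<open>n\<close> to \<open>Suc n\<close>.\<close>

lemma flow_mult: "flow x0 y0 (f * g) = flow x0 y0 f * flow x0 y0 g"
proof (rule fps_ext)
  show "fps_nth (flow x0 y0 (f * g)) n = fps_nth (flow x0 y0 f * flow x0 y0 g) n" for n
  proof (induction n arbitrary: f g)
    case 0
    then show ?case by (simp add: flow_0 bev_hom)
  next
    case (Suc n)
    have "of_nat (Suc n) * fps_nth (flow x0 y0 (f * g)) (Suc n) = fps_nth (fps_deriv (flow x0 y0 (f * g))) n"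
      by simp
    also have "\<dots> = fps_nth (fps_deriv (flow x0 y0 f * flow x0 y0 g)) n"
      by (simp add: fps_deriv_flow Dt_simps flow_add Suc)
    also have "\<dots> = of_nat (Suc n) * fps_nth (flow x0 y0 f * flow x0 y0 g) (Suc n)" 
      by (simp only: fps_deriv_nth Suc_eq_plus1)
    finally show ?case by (simp del: of_nat_Suc)
  qed
qed

lemma flow_const: "flow x0 y0 [:[:c:]:] = fps_const c"
proof (rule fps_ext)
  fix n
  have "(Dt ^^ Suc k) [:[:c:]:] = 0" for k
    by (induction k) (simp_all add: Dt_simps)
  then show "fps_nth (flow x0 y0 [:[:c:]:]) n = fps_nth (fps_const c) n"
    by (cases n) (simp_all add: flow_def del: funpow.simps)
qed

text \<open>\<open>flow\<close> is a ring homomorphism in \<open>g\<close>, hence determined by the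
  images of the variables.\<close>

lemma flow_eq_bev: "flow x0 y0 g = bev fps_const g (flow x0 y0 xv) (flow x0 y0 yv)"
  by (induction g rule: bipoly_induct) (simp_all add: flow_const flow_add flow_mult bev_hom)

lemma flow_P: "bev fps_const P (flow x0 y0 xv) (flow x0 y0 yv) = fps_const (beval P x0 y0)"
proof (rule fps_ext)
  fix n
  have "(Dt ^^ Suc k) P = 0" for k
    by (induction k) (simp_all add: Dt_simps)
  then show "fps_nth (bev fps_const P (flow x0 y0 xv) (flow x0 y0 yv)) n = fps_nth (fps_const (beval P x0 y0)) n"
    unfolding flow_eq_bev[symmetric] by (cases n) (simp_all add: flow_def del: funpow.simps)
qed

lemma flow_Q: "bev fps_const Q (flow x0 y0 xv) (flow x0 y0 yv) = fps_const (beval Q x0 y0) + fps_X"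
proof (rule fps_ext)
  fix n
  have "(Dt ^^ Suc (Suc k)) Q = 0" for k
    by (induction k) (simp_all add: Dt_simps)
  moreover have "beval 1 x0 y0 = (1::complex)" by (simp add: bev_hom)
  ultimately show "fps_nth (bev fps_const Q (flow x0 y0 xv) (flow x0 y0 yv)) n
      = fps_nth (fps_const (beval Q x0 y0) + fps_X) n"
    unfolding flow_eq_bev[symmetric]
    by (cases n; cases "n - 1") (auto simp: flow_def fps_X_def)
qed

text \<open>Solving \<open>P = P0\<close>, \<open>Q = Q0 + s\<close> for the next coefficients of \<open>x\<close> and \<open>y\<close> is a linear system
  with determinant 1, so no denominators arise.\<close>

lemma flow_integral:
  assumes S: "subring_of S" and P: "coeffs_in S P" and Q: "coeffs_in S Q"
    and x0: "x0 \<in> S" and y0: "y0 \<in> S"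
  shows "fps_nth (flow x0 y0 xv) n \<in> S \<and> fps_nth (flow x0 y0 yv) n \<in> S"
proof (induction n rule: less_induct)
  case (less n)
  show ?case
  proof (cases n)
    case 0
    then show ?thesis using x0 y0 by (simp add: flow_0)
  next
    case (Suc m)
    define X where "X = flow x0 y0 xv"
    define Y where "Y = flow x0 y0 yv"
    \<comment> \<open>Truncations known by induction; the unknown coefficients at \<open>n\<close>
      are the constant terms of \<open>A\<close> and \<open>B\<close>.\<close>
    define X' where "X' = fps_cutoff n X"
    define Y' where "Y' = fps_cutoff n Y"
    define A where "A = fps_shift n X"
    define B where "B = fps_shift n Y"
    have X: "X = X' + fps_X ^ n * A" and Y: "Y = Y' + fps_X ^ n * B"
      unfolding X'_def Y'_def A_def B_def
      by (simp_all add: fps_eq_iff fps_X_power_mult_nth)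
    have X'S: "X' \<in> {f. \<forall>n. fps_nth f n \<in> S}" and Y'S: "Y' \<in> {f. \<forall>n. fps_nth f n \<in> S}"
      using less.IH subringD(1)[OF S] by (auto simp: X'_def Y'_def X_def Y_def)
    have X0: "fps_nth X' 0 = x0" "fps_nth Y' 0 = y0"
      using Suc by (simp_all add: X'_def Y'_def X_def Y_def flow_0)
    \<comment> \<open>The Taylor remainder starts at order 2n > n, so coefficient \<open>n\<close>
      of g(X, Y) is an element of \<open>S\<close> plus a linear form in the unknowns.\<close>
    have key: "fps_nth A 0 * beval (px g) x0 y0 + fps_nth B 0 * beval (py g) x0 y0 \<in> S"
      if g: "coeffs_in S g" and tot: "fps_nth (bev fps_const g X Y) n \<in> S" for g
    proof -
      obtain r where r: "bev fps_const g X Y = bev fps_const g X' Y'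
         + fps_X ^ n * (A * bev fps_const (px g) X' Y' + B * bev fps_const (py g) X' Y') + (fps_X ^ n) ^ 2 * r"
        using taylor_rule[OF rhoms(3), of g X' "fps_X ^ n" A Y' B] unfolding X Y by blast
      have "fps_nth (bev fps_const g X Y) n = fps_nth (bev fps_const g X' Y') n
        + (fps_nth A 0 * beval (px g) x0 y0 + fps_nth B 0 * beval (py g) x0 y0)"
      proof -
        have "0 < n" using Suc by simp
        then show ?thesis unfolding r power_mult[symmetric]
          by (simp add: fps_X_power_mult_nth fps_nth_bev X0)
      qed
      moreover have "bev fps_const g X' Y' \<in> {f. \<forall>n. fps_nth f n \<in> S}"
        using X'S Y'S g subringD(1)[OF S]
        by (intro bev_in_subring[OF rhoms(3) subring_fps[OF S], of S]) auto
      ultimately show ?thesis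
        using subringD(4)[OF S tot, of "fps_nth (bev fps_const g X' Y') n"] by simp
    qed
    have "fps_nth (bev fps_const P X Y) n \<in> S" "fps_nth (bev fps_const Q X Y) n \<in> S"
      unfolding X_def Y_def flow_P flow_Q using Suc subringD[OF S] by (auto simp: fps_X_def)
    note kP = key[OF P this(1)] and kQ = key[OF Q this(2)]
    have ev: "beval g x0 y0 \<in> S" if "coeffs_in S g" for g
      using bev_in_subring[OF rhoms(1) S _ that x0 y0] by simp
    note e = ev[OF coeffs_in_px[OF S P]] ev[OF coeffs_in_py[OF S P]]
      ev[OF coeffs_in_px[OF S Q]] ev[OF coeffs_in_py[OF S Q]]
    have j: "beval (px P) x0 y0 * beval (py Q) x0 y0 - beval (py P) x0 y0 * beval (px Q) x0 y0 = 1"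
      using arg_cong[OF jac, of "\<lambda>g. beval g x0 y0"] by (simp add: bev_hom)
    \<comment> \<open>Cramer's rule with determinant 1 recovers the unknowns from the two linear
      forms.\<close>
    have "u = (u * p1 + v * p2) * q2 - (u * q1 + v * q2) * p2"
         "v = (u * q1 + v * q2) * p1 - (u * p1 + v * p2) * q1"
      if "p1 * q2 - p2 * q1 = 1" for u v p1 p2 q1 q2 :: complex
      using that by algebra+
    from this[OF j] have "fps_nth A 0 \<in> S" "fps_nth B 0 \<in> S"
      using kP kQ e subringD(4,5)[OF S] by metis+
    then show ?thesis by (simp add: A_def B_def X_def Y_def)
  qed
qed

end

section \<open>Fibres of \<open>Q\<close> on the curve \<open>P = 0\<close>\<close>

text \<open>Fraction-free elimination of the last coordinate, so that coefficients may be
  polynomials.\<close>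

lemma vectors_dependent:
  fixes v :: "'i \<Rightarrow> nat \<Rightarrow> 'r::idom"
  assumes "finite J" "card J > n"
  shows "\<exists>c. (\<exists>j\<in>J. c j \<noteq> 0) \<and> (\<forall>i<n. (\<Sum>j\<in>J. c j * v j i) = 0)"
  using assms
proof (induction n arbitrary: J v)
  case 0
  then have "J \<noteq> {}" by auto
  then show ?case by (intro exI[of _ "\<lambda>_. 1"]) auto
next
  case (Suc n)
  show ?case
  proof (cases "\<forall>j\<in>J. v j n = 0")
    case True
    obtain c where c: "\<exists>j\<in>J. c j \<noteq> 0" "\<forall>i<n. (\<Sum>j\<in>J. c j * v j i) = 0"
      using Suc.IH[of J v] Suc.prems by auto
    moreover have "(\<Sum>j\<in>J. c j * v j n) = 0" using True by simp
    ultimately show ?thesis by (metis less_Suc_eq)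
  next
    case False
    then obtain k where k: "k \<in> J" "v k n \<noteq> 0" by blast
    \<comment> \<open>Cross-multiplication with the pivot \<open>v k n\<close> annihilates
      coordinate \<open>n\<close>.\<close>
    define w where "w j i = v k n * v j i - v j n * v k i" for j i
    have "card (J - {k}) > n" using Suc.prems k by simp
    then obtain c where c: "\<exists>j\<in>J-{k}. c j \<noteq> 0" "\<forall>i<n. (\<Sum>j\<in>J-{k}. c j * w j i) = 0"
      using Suc.IH[of "J - {k}" w] Suc.prems by auto
    define c' where "c' j = (if j = k then - (\<Sum>i\<in>J-{k}. c i * v i n) else c j * v k n)" for j
    have "(\<Sum>j\<in>J. c' j * v j i) = (\<Sum>j\<in>J-{k}. c j * w j i)" for i
    proof -
      have "(\<Sum>j\<in>J. c' j * v j i) = c' k * v k i + (\<Sum>j\<in>J-{k}. c' j * v j i)"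
        using Suc.prems k by (simp add: sum.remove)
      also have "(\<Sum>j\<in>J-{k}. c' j * v j i) = (\<Sum>j\<in>J-{k}. c j * v k n * v j i)"
        by (intro sum.cong) (auto simp: c'_def)
      also have "c' k * v k i = - (\<Sum>j\<in>J-{k}. c j * v j n * v k i)"
        by (simp add: c'_def sum_distrib_right)
      also have "- (\<Sum>j\<in>J-{k}. c j * v j n * v k i) + (\<Sum>j\<in>J-{k}. c j * v k n * v j i)
          = (\<Sum>j\<in>J-{k}. c j * w j i)"
        by (simp add: w_def algebra_simps sum_subtractf)
      finally show ?thesis .
    qed
    moreover have "w j n = 0" for j by (simp add: w_def)
    ultimately have "\<forall>i<Suc n. (\<Sum>j\<in>J. c' j * v j i) = 0"
      using c(2) by (auto simp: less_Suc_eq)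
    moreover have "\<exists>j\<in>J. c' j \<noteq> 0" using c(1) k by (auto simp: c'_def)
    ultimately show ?thesis by blast
  qed
qed

section \<open>Algebraic equations satisfied on the curve\<close>

lemma bcomp_inner: "bcomp [:a:] xv V = [:a:]"
proof -
  have "bcomp [:a:] xv V = bcomp [:a:] xv yv" unfolding bev_pCons[OF rhom_cc] by simp
  then show ?thesis by simp
qed

text \<open>Pseudo-division by \<open>P\<close> reduces the powers of \<open>Q\<close> up to
  exponent \<open>degree P\<close> to remainders with only \<open>degree P\<close> coefficients in
  y. These are linearly dependent over the polynomials in x.\<close>

lemma algebraic_dependence:
  fixes P Q :: "'a::idom poly poly"
  assumes "P \<noteq> 0"
  shows "\<exists>m A. m \<noteq> 0 \<and> bcomp m xv Q = A * P"
proof -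
  have "\<exists>k q r. k \<noteq> 0 \<and> smult k (Q ^ j) = P * q + r \<and> (r = 0 \<or> degree r < degree P)" for j
    using pseudo_divmod[OF assms, of "Q ^ j"] assms
    by (metis leading_coeff_neq_0 power_not_zero prod.exhaust)
  then obtain k q r where k: "\<And>j. k j \<noteq> 0" and qr: "\<And>j. smult (k j) (Q ^ j) = P * q j + r j"
    and r: "\<And>j. r j = 0 \<or> degree (r j) < degree P" by metis
  obtain c where c: "\<exists>j\<in>{..degree P}. c j \<noteq> 0"
    "\<forall>i<degree P. (\<Sum>j\<in>{..degree P}. c j * coeff (r j) i) = 0"
    using vectors_dependent[of "{..degree P}" "degree P" "\<lambda>j i. coeff (r j) i"] by auto
  have r0: "(\<Sum>j\<le>degree P. smult (c j) (r j)) = 0"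
  proof (rule poly_eqI)
    fix i
    show "coeff (\<Sum>j\<le>degree P. smult (c j) (r j)) i = coeff 0 i"
    proof (cases "i < degree P")
      case True
      then show ?thesis using c(2) by (simp add: coeff_sum)
    next
      case False
      then have "coeff (r j) i = 0" for j using r[of j] by (auto intro: coeff_eq_0)
      then show ?thesis by (simp add: coeff_sum)
    qed
  qed
  define m where "m = (\<Sum>j\<le>degree P. monom (c j * k j) j)"
  have "coeff m j = (if j \<le> degree P then c j * k j else 0)" for j
    by (simp add: m_def coeff_sum)
  then have m: "m \<noteq> 0" using c(1) k by (metis atMost_iff coeff_0 mult_eq_0_iff)
  have "bcomp m xv Q = (\<Sum>j\<le>degree P. smult (c j) (smult (k j) (Q ^ j)))"
  proof -
    have "bcomp (monom a j) xv Q = smult a (Q ^ j)" for a j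
    proof -
      have "monom a j = [:a:] * yv ^ j" by (simp add: monom_altdef)
      then show ?thesis
        by (simp only: bev_hom(4)[OF rhom_cc] rhom_power[OF rhom_bev[OF rhom_cc]] bcomp_inner bev_vars[OF rhom_cc])
           simp
    qed
    then show ?thesis by (simp add: m_def rhom_sum[OF rhom_bev[OF rhom_cc]])
  qed
  also have "\<dots> = P * (\<Sum>j\<le>degree P. smult (c j) (q j))"
    unfolding qr using r0 by (simp add: smult_add_right sum.distrib sum_distrib_left)
  also have "\<dots> = (\<Sum>j\<le>degree P. smult (c j) (q j)) * P" by (rule mult.commute)
  finally show ?thesis using m by blast
qed

lemma swap_swap: "bcomp (bcomp g yv xv) yv xv = g"
  by (subst bev_bcomp[OF rhom_cc]) simp

text \<open>With the variables of \<open>m\<close> exchanged, x becomes on the curve a root of a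
  polynomial whose coefficients are polynomials in \<open>Q\<close>.\<close>

lemma algebraic_dependence_x:
  fixes P Q :: "'a::idom poly poly"
  assumes "P \<noteq> 0"
  shows "\<exists>m A. m \<noteq> 0 \<and> bcomp m Q xv = A * P"
proof -
  obtain m A where "m \<noteq> 0" "bcomp m xv Q = A * P" using algebraic_dependence[OF assms] by blast
  moreover have "bcomp (bcomp m yv xv) Q xv = bcomp m xv Q"
    by (subst bev_bcomp[OF rhom_cc]) simp
  moreover have "bcomp m yv xv \<noteq> 0" using swap_swap[of m] \<open>m \<noteq> 0\<close> by force
  ultimately show ?thesis by metis
qed

lemma algebraic_dependence_y:
  fixes P Q :: "'a::idom poly poly"
  assumes "P \<noteq> 0"
  shows "\<exists>m A. m \<noteq> 0 \<and> bcomp m Q yv = A * P"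
proof -
  let ?s = "\<lambda>g. bcomp g yv xv"
  have "?s P \<noteq> 0" using swap_swap[of P] assms by force
  then obtain m A where "m \<noteq> 0" and A: "bcomp m (?s Q) xv = A * ?s P"
    using algebraic_dependence_x by blast
  have "bcomp m Q yv = ?s (bcomp m (?s Q) xv)"
    by (subst bev_bcomp[OF rhom_cc]) (simp add: swap_swap)
  also have "\<dots> = ?s A * P" unfolding A by (simp add: bev_hom swap_swap)
  finally show ?thesis using \<open>m \<noteq> 0\<close> by blast
qed

section \<open>Root bounds, finiteness and boundedness of fibres\<close>

lemma root_bound:
  fixes p :: "complex poly"
  assumes "coeff p k \<noteq> 0" "degree p = k" "poly p z = 0"
  shows "cmod z \<le> 1 + (\<Sum>i<k. cmod (coeff p i) / cmod (coeff p k))"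
proof (cases "cmod z \<le> 1")
  case True
  then show ?thesis by (simp add: add_increasing2 sum_nonneg)
next
  case z: False
  have k: "k \<noteq> 0"
  proof
    assume "k = 0"
    then obtain c where "p = [:c:]" using assms(2) by (metis degree_eq_zeroE)
    then show False using assms \<open>k = 0\<close> by simp
  qed
  have "poly p z = (\<Sum>i<k. coeff p i * z ^ i) + coeff p k * z ^ k"
    using assms(2) by (simp add: poly_altdef lessThan_Suc_atMost[symmetric])
  then have "coeff p k * z ^ k = - (\<Sum>i<k. coeff p i * z ^ i)" using assms(3) by (simp add: eq_neg_iff_add_eq_0 add.commute)
  then have "cmod (coeff p k) * cmod z ^ k = cmod (\<Sum>i<k. coeff p i * z ^ i)"
    by (metis norm_minus_cancel norm_mult norm_power)
  also have "\<dots> \<le> (\<Sum>i<k. cmod (coeff p i) * cmod z ^ (k - 1))"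
  proof (rule sum_norm_le)
    fix i assume "i \<in> {..<k}"
    \<comment> \<open>For modulus above 1, each lower power is at most the power
      \<open>k - 1\<close>, which then cancels.\<close>
    then have "cmod z ^ i \<le> cmod z ^ (k - 1)" using z by (intro power_increasing) auto
    then show "cmod (coeff p i * z ^ i) \<le> cmod (coeff p i) * cmod z ^ (k - 1)"
      by (simp add: norm_mult norm_power mult_left_mono)
  qed
  also have "\<dots> = (\<Sum>i<k. cmod (coeff p i)) * cmod z ^ (k - 1)" by (simp add: sum_distrib_right)
  also have "cmod z ^ k = cmod z * cmod z ^ (k - 1)" using k by (metis power_eq_if)
  finally have "(cmod (coeff p k) * cmod z) * cmod z ^ (k - 1) \<le> (\<Sum>i<k. cmod (coeff p i)) * cmod z ^ (k - 1)"
    by (simp add: mult.assoc)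
  then have "cmod (coeff p k) * cmod z \<le> (\<Sum>i<k. cmod (coeff p i))"
    by (rule mult_right_le_imp_le) (intro zero_less_power, use z in linarith)
  then have "cmod z \<le> (\<Sum>i<k. cmod (coeff p i)) / cmod (coeff p k)"
    using assms(1) by (simp add: field_simps)
  then show ?thesis by (simp add: sum_divide_distrib)
qed

lemma map_poly_ident [simp]: "map_poly (\<lambda>c. c) p = p"
  by (rule poly_eqI) (simp add: coeff_map_poly)

lemma beval_altdef: "beval m t z = poly (map_poly (\<lambda>c. poly c t) m) z"
  by (simp add: bev_def)

lemma uniform_root_bound:
  fixes m :: "complex poly poly"
  assumes K: "compact K" and nz: "\<And>t. t \<in> K \<Longrightarrow> poly (lead_coeff m) t \<noteq> 0"
  shows "\<exists>B. \<forall>t\<in>K. \<forall>z. beval m t z = 0 \<longrightarrow> cmod z \<le> B"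
proof -
  let ?f = "\<lambda>t. 1 + (\<Sum>i<degree m. cmod (poly (coeff m i) t) / cmod (poly (lead_coeff m) t))"
  have "continuous_on K ?f"
    using nz by (intro continuous_intros) auto
  then have "bounded (?f ` K)" using K by (intro compact_imp_bounded compact_continuous_image)
  then obtain B where B: "\<And>t. t \<in> K \<Longrightarrow> norm (?f t) \<le> B" unfolding bounded_iff by blast
  have "cmod z \<le> B" if "t \<in> K" "beval m t z = 0" for t z
  proof -
    let ?p = "map_poly (\<lambda>c. poly c t) m"
    have c: "coeff ?p i = poly (coeff m i) t" for i by (simp add: coeff_map_poly)
    have "degree ?p \<le> degree m" by (rule degree_le) (simp add: c coeff_eq_0)
    moreover have "coeff ?p (degree m) \<noteq> 0" using nz[OF that(1)] by (simp add: c)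
    ultimately have "degree ?p = degree m" by (metis le_degree order_antisym)
    then have "cmod z \<le> ?f t"
      using root_bound[of ?p "degree m" z] nz[OF that(1)] that(2) by (simp add: c beval_altdef)
    also have "\<dots> \<le> B" using B[OF that(1)] by simp
    finally show ?thesis .
  qed
  then show ?thesis by blast
qed

text \<open>The factor T - t is divided out of all coefficients until specialization at
  \<open>t\<close> is nonzero; each division lowers the degree of the leading coefficient.\<close>

lemma split_off_content:
  fixes m :: "complex poly poly"
  assumes "m \<noteq> 0"
  shows "\<exists>l n. m = [:[:- t, 1:] ^ l:] * n \<and> map_poly (\<lambda>c. poly c t) n \<noteq> 0"
  using assms
proof (induction "degree (lead_coeff m)" arbitrary: m rule: less_induct)
  case less
  show ?case
  proof (cases "map_poly (\<lambda>c. poly c t) m = 0")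
    case False
    moreover have "m = [:[:- t, 1:] ^ 0:] * m" by (simp add: pCons_one)
    ultimately show ?thesis by blast
  next
    case True
    let ?L = "[:- t, 1:]"
    define n where "n = map_poly (\<lambda>c. c div ?L) m"
    have "?L dvd coeff m i" for i
      using arg_cong[OF True, of "\<lambda>p. coeff p i"] by (simp add: coeff_map_poly poly_eq_0_iff_dvd)
    then have c: "coeff m i = ?L * coeff n i" for i
      unfolding n_def by (simp only: coeff_map_poly div_0 dvd_mult_div_cancel)
    have cL: "coeff ([:q:] * n) i = q * coeff n i" for q i by simp
    have m: "m = [:?L:] * n" by (rule poly_eqI) (simp only: c cL)
    have n0: "n \<noteq> 0" using m less.prems by fastforce
    have "degree m = degree n" using n0 by (subst m) (simp add: degree_mult_eq)
    then have lc: "lead_coeff m = ?L * lead_coeff n" by (simp only: c)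
    have "degree (lead_coeff m) = degree ?L + degree (lead_coeff n)"
      unfolding lc using n0 by (intro degree_mult_eq) auto
    then have "degree (lead_coeff n) < degree (lead_coeff m)" by simp
    from less.hyps[OF this n0] obtain l n' where
      "n = [:?L ^ l:] * n'" "map_poly (\<lambda>c. poly c t) n' \<noteq> 0" by blast
    moreover have "[:q:] * [:q ^ l:] = [:q ^ Suc l:]" for q :: "complex poly" by simp
    ultimately have "m = [:?L ^ Suc l:] * n'" using m by (simp only: mult.assoc[symmetric])
    then show ?thesis using \<open>map_poly (\<lambda>c. poly c t) n' \<noteq> 0\<close> by blast
  qed
qed

context ckeller
begin

text \<open>Specializing \<open>m\<close> at T = t might annihilate it. Along the flow Q = t + s, so
  the common factor (T - t)^l becomes s^l and cancels among power series; setting s = 0 then leaves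
  a nontrivial equation for the value of \<open>z\<close>.\<close>

lemma finite_values_on_fiber:
  assumes m: "m \<noteq> 0" and A: "bcomp m Q z = A * P"
  shows "finite {beval z x y | x y. beval P x y = 0 \<and> beval Q x y = t}"
proof -
  obtain l n where n: "m = [:[:- t, 1:] ^ l:] * n" "map_poly (\<lambda>c. poly c t) n \<noteq> 0"
    using split_off_content[OF m] by blast
  have "beval n t (beval z x y) = 0" if xy: "beval P x y = 0" "beval Q x y = t" for x y
  proof -
    let ?T = "fps_const t + fps_X" and ?X = "flow x y xv" and ?Y = "flow x y yv"
    have "bev fps_const (bcomp m Q z) ?X ?Y = 0"
      unfolding A using xy by (simp add: bev_hom flow_P)
    then have "bev fps_const m ?T (flow x y z) = 0"
      using xy by (simp add: bev_bcomp flow_Q flow_eq_bev[of x y z])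
    moreover have "bev fps_const [:[:- t, 1:] ^ l:] ?T (flow x y z) = fps_X ^ l"
    proof -
      have "[:[:- t, 1:] ^ l:] = [:[:- t, 1:]:] ^ l" by (rule rhom_power[OF rhoms(2)])
      then show ?thesis
        by (simp add: rhom_power[OF rhom_bev[OF rhoms(3)]] bev_pCons poly_map_pCons fps_const_neg[symmetric] del: fps_const_neg)
    qed
    ultimately have "bev fps_const n ?T (flow x y z) = 0"
      unfolding n(1) bev_hom(4)[OF rhoms(3)] by simp
    then have "fps_nth (bev fps_const n ?T (flow x y z)) 0 = 0" by simp
    then show ?thesis by (simp add: fps_nth_bev flow_0)
  qed
  then have "{beval z x y | x y. beval P x y = 0 \<and> beval Q x y = t}
      \<subseteq> {w. poly (map_poly (\<lambda>c. poly c t) n) w = 0}"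
    by (auto simp: beval_altdef)
  then show ?thesis using poly_roots_finite[OF n(2)] finite_subset by blast
qed

lemma finite_fiber: "finite {(x, y). beval P x y = 0 \<and> beval Q x y = t}"
proof -
  obtain m A where "m \<noteq> 0" "bcomp m Q xv = A * P"
    using algebraic_dependence_x[OF P_nonzero] by blast
  from finite_values_on_fiber[OF this] have x: "finite {x | x y. beval P x y = 0 \<and> beval Q x y = t}" by simp
  obtain m A where "m \<noteq> 0" "bcomp m Q yv = A * P"
    using algebraic_dependence_y[OF P_nonzero] by blast
  from finite_values_on_fiber[OF this] have y: "finite {y | x y. beval P x y = 0 \<and> beval Q x y = t}" by simp
  show ?thesis by (rule finite_subset[OF _ finite_cartesian_product[OF x y]]) auto
qed

text \<open>\<open>R\<close> collects the zeros of the leading coefficients in the equations of x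
  and y over \<open>Q\<close>, the only values over which a branch can escape to infinity.\<close>

lemma bounded_fibers:
  "\<exists>R. finite R \<and> (\<forall>K. compact K \<and> K \<inter> R = {} \<longrightarrow>
     (\<exists>B. \<forall>x y. beval P x y = 0 \<and> beval Q x y \<in> K \<longrightarrow> cmod x \<le> B \<and> cmod y \<le> B))"
proof -
  obtain m A where m: "m \<noteq> 0" "bcomp m Q xv = A * P"
    using algebraic_dependence_x[OF P_nonzero] by blast
  obtain n C where n: "n \<noteq> 0" "bcomp n Q yv = C * P"
    using algebraic_dependence_y[OF P_nonzero] by blast
  have mx: "beval m (beval Q x y) x = 0" if "beval P x y = 0" for x y
    using arg_cong[OF m(2), of "\<lambda>g. beval g x y"] that by (simp add: bev_bcomp bev_hom)
  have ny: "beval n (beval Q x y) y = 0" if "beval P x y = 0" for x y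
    using arg_cong[OF n(2), of "\<lambda>g. beval g x y"] that by (simp add: bev_bcomp bev_hom)
  let ?R = "{t. poly (lead_coeff m * lead_coeff n) t = 0}"
  have "finite ?R" using m n by (intro poly_roots_finite) auto
  moreover have "\<exists>B. \<forall>x y. beval P x y = 0 \<and> beval Q x y \<in> K \<longrightarrow> cmod x \<le> B \<and> cmod y \<le> B"
    if K: "compact K" "K \<inter> ?R = {}" for K
  proof -
    have "poly (lead_coeff m) t \<noteq> 0" "poly (lead_coeff n) t \<noteq> 0" if "t \<in> K" for t
      using K(2) that by auto
    note nz = this
    obtain B where B: "\<And>t z. t \<in> K \<Longrightarrow> beval m t z = 0 \<Longrightarrow> cmod z \<le> B"
      using uniform_root_bound[OF K(1) nz(1)] by blast
    obtain B' where B': "\<And>t z. t \<in> K \<Longrightarrow> beval n t z = 0 \<Longrightarrow> cmod z \<le> B'"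
      using uniform_root_bound[OF K(1) nz(2)] by blast
    have "cmod x \<le> max B B' \<and> cmod y \<le> max B B'" if "beval P x y = 0" "beval Q x y \<in> K" for x y
      using B[OF that(2) mx[OF that(1)]] B'[OF that(2) ny[OF that(1)]] by linarith
    then show ?thesis by blast
  qed
  ultimately show ?thesis by blast
qed

end

section \<open>Gaussian integers and the choice of the base point\<close>

lemma gaussian_iff: "z \<in> gaussian_ints \<longleftrightarrow> Re z \<in> \<int> \<and> Im z \<in> \<int>"
  unfolding gaussian_ints_def by (auto simp: complex_eq_iff elim!: Ints_cases)

lemma subring_gaussian: "subring_of gaussian_ints"
  by (simp add: subring_of_def gaussian_iff)

lemma finite_gaussian_cball: "finite (gaussian_ints \<inter> cball c r)"
proof -
  let ?I = "\<lambda>u. {\<lfloor>u - r\<rfloor>..\<lceil>u + r\<rceil>}"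
  have "gaussian_ints \<inter> cball c r \<subseteq> (\<lambda>(a, b). Complex (of_int a) (of_int b)) ` (?I (Re c) \<times> ?I (Im c))"
  proof
    fix z assume z: "z \<in> gaussian_ints \<inter> cball c r"
    then obtain a b where ab: "z = Complex (of_int a) (of_int b)" by (auto simp: gaussian_ints_def)
    have "\<bar>Re (z - c)\<bar> \<le> r" "\<bar>Im (z - c)\<bar> \<le> r"
      using z abs_Re_le_cmod[of "z - c"] abs_Im_le_cmod[of "z - c"] by (auto simp: dist_norm norm_minus_commute)
    then have "a \<in> ?I (Re c)" "b \<in> ?I (Im c)" by (auto simp: ab) linarith+
    then show "z \<in> (\<lambda>(a, b). Complex (of_int a) (of_int b)) ` (?I (Re c) \<times> ?I (Im c))"
      using ab by auto
  qed
  then show ?thesis by (rule finite_subset) auto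
qed

lemma (in ckeller) good_point:
  assumes Q: "coeffs_in gaussian_ints Q"
    and inf: "infinite {(x, y). x \<in> gaussian_ints \<and> y \<in> gaussian_ints \<and> beval P x y = 0}" (is "infinite ?S")
  shows "\<exists>x0 y0 B. x0 \<in> gaussian_ints \<and> y0 \<in> gaussian_ints \<and> beval P x0 y0 = 0 \<and>
    (\<forall>x y. beval P x y = 0 \<and> beval Q x y \<in> cball (beval Q x0 y0) 2 \<longrightarrow> cmod x \<le> B \<and> cmod y \<le> B)"
proof -
  obtain R where "finite R" and R: "\<forall>K. compact K \<and> K \<inter> R = {} \<longrightarrow>
     (\<exists>B. \<forall>x y. beval P x y = 0 \<and> beval Q x y \<in> K \<longrightarrow> cmod x \<le> B \<and> cmod y \<le> B)"
    using bounded_fibers by (elim exE conjE)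
  let ?q = "\<lambda>(x, y). beval Q x y"
  have "infinite (?q ` ?S)"
  proof
    assume "finite (?q ` ?S)"
    \<comment> \<open>Infinitely many integral points would share one value of \<open>Q\<close>,
      against the finiteness of the fibre.\<close>
    from inf_img_fin_domE'[OF this inf] obtain t where "infinite (?q -` {t} \<inter> ?S)" by blast
    moreover have "?q -` {t} \<inter> ?S \<subseteq> {(x, y). beval P x y = 0 \<and> beval Q x y = t}" by auto
    ultimately show False using finite_fiber finite_subset by blast
  qed
  moreover have "finite (\<Union>r\<in>R. gaussian_ints \<inter> cball r 2)"
    using \<open>finite R\<close> finite_gaussian_cball by blast
  ultimately have "\<not> ?q ` ?S \<subseteq> (\<Union>r\<in>R. gaussian_ints \<inter> cball r 2)" using finite_subset by blast
  then obtain p where "p \<in> ?S" and p: "?q p \<notin> (\<Union>r\<in>R. gaussian_ints \<inter> cball r 2)" by blast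
  obtain x0 y0 where [simp]: "p = (x0, y0)" by (cases p)
  have xy: "x0 \<in> gaussian_ints" "y0 \<in> gaussian_ints" "beval P x0 y0 = 0" using \<open>p \<in> ?S\<close> by auto
  have "beval Q x0 y0 \<in> gaussian_ints"
    using bev_in_subring[OF rhoms(1) subring_gaussian _ Q xy(1,2)] by simp
  then have "cball (beval Q x0 y0) 2 \<inter> R = {}" using p by (auto simp: dist_commute)
  then have "\<exists>B. \<forall>x y. beval P x y = 0 \<and> beval Q x y \<in> cball (beval Q x0 y0) 2
      \<longrightarrow> cmod x \<le> B \<and> cmod y \<le> B"
    by (intro R[rule_format] conjI compact_cball)
  then obtain B where B: "\<forall>x y. beval P x y = 0 \<and> beval Q x y \<in> cball (beval Q x0 y0) 2
      \<longrightarrow> cmod x \<le> B \<and> cmod y \<le> B" ..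
  show ?thesis by (rule exI[of _ x0], rule exI[of _ y0], rule exI[of _ B]) (intro conjI xy B)
qed

section \<open>The radius of convergence of the flow\<close>

definition seminorm :: "('a::comm_ring_1 \<Rightarrow> real) \<Rightarrow> bool" where
  "seminorm \<nu> \<longleftrightarrow> \<nu> 0 = 0 \<and> (\<forall>a. \<nu> a \<ge> 0 \<and> \<nu> (- a) = \<nu> a) \<and>
     (\<forall>a b. \<nu> (a + b) \<le> \<nu> a + \<nu> b \<and> \<nu> (a * b) \<le> \<nu> a * \<nu> b)"

text \<open>A weighted l1-norm of the coefficients. It bounds values on the disc of radius
  \<open>B\<close>; iterated, it bounds them on a bidisc.\<close>

definition pnorm :: "('a::comm_ring_1 \<Rightarrow> real) \<Rightarrow> real \<Rightarrow> 'a poly \<Rightarrow> real" where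
  "pnorm \<nu> B p = poly (map_poly \<nu> p) B"

lemma seminormD:
  assumes "seminorm \<nu>"
  shows "\<nu> 0 = 0" "\<nu> a \<ge> 0" "\<nu> (- a) = \<nu> a" "\<nu> (a + b) \<le> \<nu> a + \<nu> b" "\<nu> (a * b) \<le> \<nu> a * \<nu> b"
    "\<nu> (a - b) \<le> \<nu> a + \<nu> b"
proof -
  show 1: "\<nu> 0 = 0" "\<nu> a \<ge> 0" "\<And>a. \<nu> (- a) = \<nu> a" "\<And>a b. \<nu> (a + b) \<le> \<nu> a + \<nu> b" "\<nu> (a * b) \<le> \<nu> a * \<nu> b" for a b
    using assms by (auto simp: seminorm_def)
  show "\<nu> (a - b) \<le> \<nu> a + \<nu> b" using 1(4)[of a "- b"] 1(3)[of b] by simp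
qed

lemma seminorm_of_nat: "seminorm \<nu> \<Longrightarrow> \<nu> (of_nat n * a) \<le> of_nat n * \<nu> a"
proof (induction n)
  case (Suc n)
  then show ?case using seminormD(4)[of \<nu> a "of_nat n * a"] by (simp add: distrib_right)
qed (simp add: seminormD)

lemma pnorm_pCons: "seminorm \<nu> \<Longrightarrow> pnorm \<nu> B (pCons a p) = \<nu> a + B * pnorm \<nu> B p"
  by (simp add: pnorm_def map_poly_pCons seminormD)

lemma pnorm_0 [simp]: "pnorm \<nu> B 0 = 0"
  by (simp add: pnorm_def)

lemma poly_map_poly_sum:
  fixes f :: "'a::zero \<Rightarrow> 'b::comm_semiring_1"
  assumes "f 0 = 0" "degree p \<le> n"
  shows "poly (map_poly f p) x = (\<Sum>i\<le>n. f (coeff p i) * x ^ i)"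
proof -
  have "degree (map_poly f p) \<le> n"
    by (rule degree_le) (use assms in \<open>simp add: coeff_map_poly coeff_eq_0\<close>)
  then have "poly (map_poly f p) x = (\<Sum>i\<le>n. coeff (map_poly f p) i * x ^ i)"
    unfolding poly_altdef by (intro sum.mono_neutral_left) (auto simp: coeff_eq_0)
  then show ?thesis using assms by (simp add: coeff_map_poly)
qed

lemma pnorm_sum:
  "seminorm \<nu> \<Longrightarrow> degree p \<le> n \<Longrightarrow> pnorm \<nu> B p = (\<Sum>i\<le>n. \<nu> (coeff p i) * B ^ i)"
  unfolding pnorm_def by (rule poly_map_poly_sum) (simp_all add: seminormD)

lemma seminorm_cmod: "seminorm cmod"
  by (simp add: seminorm_def norm_triangle_ineq norm_mult)

lemma seminorm_pnorm:
  assumes \<nu>: "seminorm \<nu>" and B: "B \<ge> 0"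
  shows "seminorm (pnorm \<nu> B)"
proof -
  have nn: "pnorm \<nu> B p \<ge> 0" for p
    by (induction p) (auto simp: pnorm_pCons \<nu> seminormD B)
  have neg: "pnorm \<nu> B (- p) = pnorm \<nu> B p" for p
    by (induction p) (auto simp: pnorm_pCons \<nu> seminormD)
  have add: "pnorm \<nu> B (p + q) \<le> pnorm \<nu> B p + pnorm \<nu> B q" for p q
  proof (induction p q rule: poly_induct2)
    case (pCons a p b q)
    then have "B * pnorm \<nu> B (p + q) \<le> B * (pnorm \<nu> B p + pnorm \<nu> B q)" by (intro mult_left_mono B)
    then show ?case using seminormD(4)[OF \<nu>, of a b] by (simp add: pnorm_pCons \<nu> distrib_left)
  qed simp
  have smult: "pnorm \<nu> B (smult a q) \<le> \<nu> a * pnorm \<nu> B q" for a q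
  proof (induction q)
    case (pCons b q)
    then have "B * pnorm \<nu> B (smult a q) \<le> B * (\<nu> a * pnorm \<nu> B q)" by (intro mult_left_mono B)
    then show ?case using seminormD(5)[OF \<nu>, of a b] by (simp add: pnorm_pCons \<nu> algebra_simps)
  qed simp
  have "pnorm \<nu> B (p * q) \<le> pnorm \<nu> B p * pnorm \<nu> B q" for p q
  proof (induction p)
    case (pCons a p)
    have "pnorm \<nu> B (pCons a p * q) \<le> pnorm \<nu> B (smult a q) + pnorm \<nu> B (pCons 0 (p * q))"
      unfolding mult_pCons_left by (rule add)
    also have "\<dots> \<le> \<nu> a * pnorm \<nu> B q + B * (pnorm \<nu> B p * pnorm \<nu> B q)"
      using smult pCons(2) by (simp add: pnorm_pCons \<nu> seminormD add_mono mult_left_mono B)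
    also have "\<dots> = pnorm \<nu> B (pCons a p) * pnorm \<nu> B q" by (simp add: pnorm_pCons \<nu> algebra_simps)
    finally show ?case .
  qed simp
  then show ?thesis using nn neg add by (simp add: seminorm_def)
qed

text \<open>Termwise, i B^(i-1) is at most n B^i, since \<open>B\<close> is at least 1.\<close>

lemma pnorm_pderiv:
  fixes p :: "'a::idom poly"
  assumes \<nu>: "seminorm \<nu>" and B: "B \<ge> 1" and n: "degree p \<le> n"
  shows "pnorm \<nu> B (pderiv p) \<le> n * pnorm \<nu> B p"
proof -
  have "degree (pderiv p) \<le> n" using n
    by (intro degree_le) (simp add: coeff_pderiv coeff_eq_0)
  then have "pnorm \<nu> B (pderiv p) = (\<Sum>i\<le>n. \<nu> (coeff (pderiv p) i) * B ^ i)"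
    by (rule pnorm_sum[OF \<nu>])
  also have "\<dots> = (\<Sum>i<n. \<nu> (coeff (pderiv p) i) * B ^ i)"
    using n by (simp add: lessThan_Suc_atMost[symmetric] coeff_pderiv coeff_eq_0 seminormD \<nu>)
  also have "\<dots> \<le> (\<Sum>i<n. n * (\<nu> (coeff p (Suc i)) * B ^ Suc i))"
  proof (rule sum_mono)
    fix i assume i: "i \<in> {..<n}"
    have "\<nu> (coeff (pderiv p) i) \<le> of_nat (Suc i) * \<nu> (coeff p (Suc i))"
      unfolding coeff_pderiv by (rule seminorm_of_nat[OF \<nu>])
    also have "\<dots> \<le> n * \<nu> (coeff p (Suc i))"
      using i by (intro mult_right_mono seminormD(2)[OF \<nu>]) auto
    finally have "\<nu> (coeff (pderiv p) i) * B ^ i \<le> (n * \<nu> (coeff p (Suc i))) * B ^ Suc i"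
      using B by (intro mult_mono power_increasing mult_nonneg_nonneg seminormD(2)[OF \<nu>]) auto
    then show "\<nu> (coeff (pderiv p) i) * B ^ i \<le> n * (\<nu> (coeff p (Suc i)) * B ^ Suc i)"
      by (simp only: mult.assoc)
  qed
  also have "\<dots> = n * (\<Sum>i\<in>{1..n}. \<nu> (coeff p i) * B ^ i)"
    unfolding sum_distrib_left[symmetric] by (simp add: sum.atLeast1_atMost_eq)
  also have "\<dots> \<le> n * (\<Sum>i\<le>n. \<nu> (coeff p i) * B ^ i)"
    using B by (intro mult_left_mono sum_mono2) (auto intro!: mult_nonneg_nonneg seminormD(2)[OF \<nu>])
  also have "\<dots> = n * pnorm \<nu> B p" using pnorm_sum[OF \<nu> n] by simp
  finally show ?thesis .
qed

lemma pnorm_map_le: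
  assumes \<nu>: "seminorm \<nu>" and B: "B \<ge> 0" and f: "\<And>i. \<nu> (f (coeff p i)) \<le> c * \<nu> (coeff p i)" and "f 0 = 0"
  shows "pnorm \<nu> B (map_poly f p) \<le> c * pnorm \<nu> B p"
proof -
  have "degree (map_poly f p) \<le> degree p"
    by (rule degree_le) (simp add: coeff_map_poly \<open>f 0 = 0\<close> coeff_eq_0)
  then have "pnorm \<nu> B (map_poly f p) = (\<Sum>i\<le>degree p. \<nu> (f (coeff p i)) * B ^ i)"
    by (simp add: pnorm_sum[OF \<nu>] coeff_map_poly \<open>f 0 = 0\<close>)
  also have "\<dots> \<le> (\<Sum>i\<le>degree p. (c * \<nu> (coeff p i)) * B ^ i)"
    using B f by (intro sum_mono mult_right_mono) auto
  also have "\<dots> = c * pnorm \<nu> B p" by (simp add: pnorm_sum[OF \<nu> order_refl] sum_distrib_left mult.assoc)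
  finally show ?thesis .
qed

section \<open>Norms and degrees in two variables\<close>

definition bnorm :: "real \<Rightarrow> complex poly poly \<Rightarrow> real" where
  "bnorm B = pnorm (pnorm cmod B) B"

definition bideg_le :: "nat \<Rightarrow> complex poly poly \<Rightarrow> bool" where
  "bideg_le n g \<longleftrightarrow> degree g \<le> n \<and> (\<forall>i. degree (coeff g i) \<le> n)"

lemma bideg_le_mult: "bideg_le m f \<Longrightarrow> bideg_le n g \<Longrightarrow> bideg_le (m + n) (f * g)"
  unfolding bideg_le_def
proof safe
  assume "degree f \<le> m" "degree g \<le> n"
  then show "degree (f * g) \<le> m + n" using degree_mult_le[of f g] by linarith
next
  fix i assume "\<forall>i. degree (coeff f i) \<le> m" "\<forall>i. degree (coeff g i) \<le> n"
  then show "degree (coeff (f * g) i) \<le> m + n"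
    unfolding coeff_mult by (intro degree_sum_le order_trans[OF degree_mult_le] add_mono) auto
qed

lemma bideg_le_diff: "bideg_le n f \<Longrightarrow> bideg_le n g \<Longrightarrow> bideg_le n (f - g)"
  unfolding bideg_le_def by (auto intro: degree_diff_le)

lemma degree_pderiv_le: "degree p \<le> n \<Longrightarrow> degree (pderiv p) \<le> n" for p :: "'a::{idom, ring_char_0} poly"
  by (simp add: degree_pderiv)

lemma bideg_le_px: "bideg_le n g \<Longrightarrow> bideg_le n (px g)"
proof -
  assume g: "bideg_le n g"
  have "degree (px g) \<le> n"
    by (rule degree_le) (use g in \<open>auto simp: coeff_px bideg_le_def coeff_eq_0\<close>)
  then show ?thesis using g by (auto simp: bideg_le_def coeff_px degree_pderiv_le)
qed

lemma bideg_le_py: "bideg_le n g \<Longrightarrow> bideg_le n (py g)"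
  unfolding bideg_le_def by (auto simp: coeff_pderiv of_nat_poly intro!: degree_pderiv_le simp del: of_nat_Suc)

lemma bideg_le_exists: "\<exists>n. bideg_le n g"
proof -
  have "degree (coeff g i) \<le> (\<Sum>i\<le>degree g. degree (coeff g i))" for i
  proof (cases "i \<le> degree g")
    case True
    then show ?thesis by (intro member_le_sum) auto
  qed (simp add: coeff_eq_0)
  then show ?thesis unfolding bideg_le_def
    by (intro exI[of _ "degree g + (\<Sum>i\<le>degree g. degree (coeff g i))"]) (auto intro: trans_le_add2)
qed

lemma bnorm_px: "bideg_le n g \<Longrightarrow> B \<ge> 1 \<Longrightarrow> bnorm B (px g) \<le> n * bnorm B g"
  unfolding bnorm_def px_def bideg_le_def
  by (intro pnorm_map_le seminorm_pnorm seminorm_cmod pnorm_pderiv) auto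

lemma bnorm_py: "bideg_le n g \<Longrightarrow> B \<ge> 1 \<Longrightarrow> bnorm B (py g) \<le> n * bnorm B g"
  unfolding bnorm_def bideg_le_def
  by (intro seminorm_pnorm seminorm_cmod pnorm_pderiv) auto

lemma seminorm_bnorm: "B \<ge> 0 \<Longrightarrow> seminorm (bnorm B)"
  unfolding bnorm_def by (intro seminorm_pnorm seminorm_cmod)

lemma poly_le_pnorm:
  assumes "cmod x \<le> B"
  shows "cmod (poly p x) \<le> pnorm cmod B p"
proof (induction p)
  case (pCons a p)
  have "cmod (x * poly p x) \<le> B * pnorm cmod B p"
    unfolding norm_mult using pCons(2) assms order_trans[OF norm_ge_zero assms] by (intro mult_mono) auto
  then show ?case using norm_triangle_ineq[of a "x * poly p x"] by (simp add: pnorm_pCons seminorm_cmod)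
qed simp

lemma beval_le_bnorm:
  assumes "cmod x \<le> B" "cmod y \<le> B"
  shows "cmod (beval g x y) \<le> bnorm B g"
proof -
  have B: "B \<ge> 0" using assms(1) norm_ge_zero order_trans by blast
  show ?thesis
  proof (induction g)
    case (pCons a g)
    have "cmod (y * beval g x y) \<le> B * bnorm B g"
      unfolding norm_mult using pCons(2) assms B by (intro mult_mono) auto
    moreover have "cmod (poly a x) \<le> pnorm cmod B a" by (rule poly_le_pnorm[OF assms(1)])
    ultimately show ?case
      using norm_triangle_ineq[of "poly a x" "y * beval g x y"]
      by (simp add: bev_pCons bnorm_def pnorm_pCons seminorm_pnorm seminorm_cmod B)
  qed (simp add: bnorm_def)
qed

text \<open>Each application of \<open>Dt\<close> raises the bidegree by at most \<open>e\<close>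
  and multiplies the norm by at most \<open>M\<close> times the current bidegree. The resulting
  factors give k! times a k-th power, uniformly on the bidisc.\<close>

lemma (in ckeller) Dt_power_bound:
  assumes B: "B \<ge> 1"
  shows "\<exists>\<rho> C. \<rho> > 0 \<and> C \<ge> 0 \<and> (\<forall>k x y. cmod x \<le> B \<and> cmod y \<le> B \<longrightarrow>
     cmod (beval ((Dt ^^ k) xv) x y) \<le> C * fact k / \<rho> ^ k \<and>
     cmod (beval ((Dt ^^ k) yv) x y) \<le> C * fact k / \<rho> ^ k)"
proof -
  obtain e where e: "bideg_le e P" using bideg_le_exists by blast
  define M where "M = bnorm B (px P) + bnorm B (py P)"
  note sn = seminorm_bnorm[of B]
  have M: "M \<ge> 0" unfolding M_def using B by (intro add_nonneg_nonneg seminormD(2)[OF sn]) auto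
  have step: "bideg_le (e + n) (Dt g)" "bnorm B (Dt g) \<le> M * (n * bnorm B g)" if "bideg_le n g" for n g
  proof -
    show "bideg_le (e + n) (Dt g)" unfolding Dt_def
      by (intro bideg_le_diff bideg_le_mult bideg_le_px bideg_le_py e that)
    have 1: "bnorm B (f * h) \<le> bnorm B f * (n * bnorm B g)" if "bnorm B h \<le> n * bnorm B g" for f h
      using order_trans[OF seminormD(5)[OF sn] mult_left_mono[OF that seminormD(2)[OF sn]]] B by simp
    have "bnorm B (Dt g) \<le> bnorm B (px P * py g) + bnorm B (py P * px g)"
      unfolding Dt_def using B by (intro seminormD(6)[OF sn]) simp
    also have "\<dots> \<le> bnorm B (px P) * (n * bnorm B g) + bnorm B (py P) * (n * bnorm B g)"
      using that B by (intro add_mono 1 bnorm_px bnorm_py)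
    finally show "bnorm B (Dt g) \<le> M * (n * bnorm B g)" by (simp add: M_def distrib_right)
  qed
  \<comment> \<open>The bidegree bound \<open>e * k + 1\<close> is at most
    \<open>(1 + e) * Suc k\<close>; the extra 1 makes \<open>q\<close> positive, as the radius
    \<open>1 / q\<close> requires.\<close>
  define q where "q = M * (1 + e) + 1"
  have q: "q \<ge> 1" using M by (simp add: q_def)
  have it: "bideg_le (e * k + 1) ((Dt ^^ k) g) \<and> bnorm B ((Dt ^^ k) g) \<le> bnorm B g * fact k * q ^ k"
    if g: "bideg_le 1 g" for k g
  proof (induction k)
    case 0
    then show ?case using g by simp
  next
    case (Suc k)
    have nn: "bnorm B g * fact k * q ^ k \<ge> 0"
      using B q seminormD(2)[OF sn, of g] by (intro mult_nonneg_nonneg) auto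
    have "bnorm B ((Dt ^^ Suc k) g) \<le> M * (real (e * k + 1) * bnorm B ((Dt ^^ k) g))"
      using step(2)[OF Suc[THEN conjunct1]] by simp
    also have "\<dots> = (M * real (e * k + 1)) * bnorm B ((Dt ^^ k) g)" by simp
    also have "\<dots> \<le> (M * real (e * k + 1)) * (bnorm B g * fact k * q ^ k)"
      using Suc M by (intro mult_left_mono mult_nonneg_nonneg) auto
    also have "\<dots> \<le> (q * real (Suc k)) * (bnorm B g * fact k * q ^ k)"
    proof (rule mult_right_mono[OF _ nn])
      have "M * real (e * k + 1) \<le> M * ((1 + e) * real (Suc k))"
        using M by (intro mult_left_mono) (auto simp: algebra_simps)
      also have "\<dots> \<le> q * real (Suc k)"
        unfolding q_def by (simp add: algebra_simps)
      finally show "M * real (e * k + 1) \<le> q * real (Suc k)" .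
    qed
    also have "\<dots> = bnorm B g * fact (Suc k) * q ^ Suc k" by (simp add: algebra_simps)
    finally show ?case using step(1)[OF Suc[THEN conjunct1]] by (simp add: algebra_simps)
  qed
  define C where "C = bnorm B xv + bnorm B yv"
  have nn: "bnorm B xv \<ge> 0" "bnorm B yv \<ge> 0" using B by (auto intro: seminormD(2)[OF sn])
  have bd: "bideg_le 1 xv" "bideg_le 1 yv"
    by (auto simp: bideg_le_def coeff_pCons split: nat.split)
  have main: "cmod (beval ((Dt ^^ k) g) x y) \<le> C * fact k / (1 / q) ^ k"
    if xy: "cmod x \<le> B" "cmod y \<le> B" and g: "bideg_le 1 g" "bnorm B g \<le> C" for k g x y
  proof -
    have "cmod (beval ((Dt ^^ k) g) x y) \<le> bnorm B g * fact k * q ^ k"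
      using beval_le_bnorm[OF xy] it[OF g(1)] order_trans by blast
    also have "\<dots> \<le> C * fact k * q ^ k" using g(2) q by (intro mult_right_mono) auto
    finally show ?thesis using q by (simp add: field_simps)
  qed
  show ?thesis
    by (rule exI[of _ "1 / q"], rule exI[of _ C])
       (use q nn main[OF _ _ bd(1)] main[OF _ _ bd(2)] in \<open>auto simp: C_def\<close>)
qed

section \<open>Cauchy estimates and continuation of power series\<close>

lemma fps_nth_deriv_iterate:
  fixes F :: "complex fps"
  shows "fact n * fps_nth ((fps_deriv ^^ k) F) n = fact (n + k) * fps_nth F (n + k)"
proof (induction k arbitrary: n)
  case (Suc k)
  have "fact n * fps_nth ((fps_deriv ^^ Suc k) F) n = fact (Suc n) * fps_nth ((fps_deriv ^^ k) F) (Suc n)"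
    by (simp add: algebra_simps)
  also have "\<dots> = fact (n + Suc k) * fps_nth F (n + Suc k)"
    unfolding Suc by simp
  finally show ?case .
qed simp

lemma fps_cauchy_bound:
  fixes G :: "complex fps"
  assumes r: "0 < r" "ereal r < fps_conv_radius G" and b: "\<And>s. cmod s = r \<Longrightarrow> cmod (eval_fps G s) \<le> C"
  shows "cmod (fps_nth G n) * r ^ n \<le> C"
proof -
  have pos: "fps_conv_radius G > 0" using r by (metis ereal_less(2) less_trans)
  have sub: "cball (0::complex) r \<subseteq> eball 0 (fps_conv_radius G)"
  proof
    fix x :: complex assume "x \<in> cball 0 r"
    then have "ereal (dist 0 x) \<le> ereal r" by simp
    then show "x \<in> eball 0 (fps_conv_radius G)" using r(2) by (simp only: in_eball_iff le_less_trans)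
  qed
  have hol: "eval_fps G holomorphic_on cball 0 r" by (rule holomorphic_on_eval_fps[OF sub])
  have "cmod ((deriv ^^ n) (eval_fps G) 0) \<le> fact n * C / r ^ n"
    using r b by (intro Cauchy_inequality holomorphic_on_imp_continuous_on hol
        holomorphic_on_subset[OF hol]) auto
  moreover have "(deriv ^^ n) (eval_fps G) 0 = fact n * fps_nth G n"
    using fps_nth_conv_deriv[OF pos, of n] by simp
  ultimately have "fact n * cmod (fps_nth G n) \<le> fact n * (C / r ^ n)" by (simp add: norm_mult)
  then have "cmod (fps_nth G n) \<le> C / r ^ n" by (rule mult_left_le_imp_le) simp
  then show ?thesis using r by (simp add: field_simps)
qed

text \<open>Comparison with the derivative of the geometric series; the factor \<open>Suc n\<close>
  counts the binomial terms summed in \<open>conv_radius_extend\<close>.\<close>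

lemma conv_radius_ge_linear_bound:
  fixes F :: "complex fps"
  assumes R: "R > 0" and b: "\<And>n. cmod (fps_nth F n) * R ^ n \<le> real (Suc n) * C"
  shows "fps_conv_radius F \<ge> ereal R"
  unfolding fps_conv_radius_def
proof (rule conv_radius_geI_ex')
  fix s :: real assume s: "0 < s" "ereal s < ereal R"
  have "summable (\<lambda>n. real (Suc n) * (s / R) ^ n)"
    using geometric_deriv_sums[of "s / R"] s by (auto simp: sums_iff)
  then have "summable (\<lambda>n. C * (real (Suc n) * (s / R) ^ n))" by (rule summable_mult)
  then show "summable (\<lambda>n. fps_nth F n * of_real s ^ n)"
  proof (rule summable_comparison_test'[where N = 0])
    fix n
    have "cmod (fps_nth F n * of_real s ^ n) = cmod (fps_nth F n) * R ^ n * (s / R) ^ n"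
      using s R by (simp add: norm_mult norm_power power_divide)
    also have "\<dots> \<le> real (Suc n) * C * (s / R) ^ n"
      using s R by (intro mult_right_mono b) auto
    finally show "cmod (fps_nth F n * of_real s ^ n) \<le> C * (real (Suc n) * (s / R) ^ n)"
      by (simp add: mult_ac)
  qed
qed

text \<open>Cauchy's estimate for all derivatives at once, summed with the binomial theorem, enlarges the
  radius of convergence by \<open>\<rho>\<close>.\<close>

lemma conv_radius_extend:
  fixes F :: "complex fps"
  assumes r: "0 \<le> r" "r = 0 \<or> ereal r < fps_conv_radius F" and \<rho>: "\<rho> > 0" and C: "C \<ge> 0"
    and b: "\<And>k s. cmod s = r \<Longrightarrow> cmod (eval_fps ((fps_deriv ^^ k) F) s) \<le> C * fact k / \<rho> ^ k"
  shows "fps_conv_radius F \<ge> ereal (r + \<rho>)"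
proof (rule conv_radius_ge_linear_bound)
  show "r + \<rho> > 0" using r \<rho> by simp
  fix N
  have c: "cmod (fps_nth ((fps_deriv ^^ k) F) n) * r ^ n \<le> C * fact k / \<rho> ^ k" for k n
  proof (cases "r = 0")
    \<comment> \<open>Convergence near 0 is not yet known here; the hypothesis then concerns
      constant terms only.\<close>
    case True
    have "0 \<le> C * fact k / \<rho> ^ k" using C \<rho> by simp
    moreover have "cmod (fps_nth ((fps_deriv ^^ k) F) 0) \<le> C * fact k / \<rho> ^ k"
      using b[of 0 k] True by (simp add: eval_fps_at_0)
    ultimately show ?thesis using True by (cases n) auto
  next
    case False
    have "fps_conv_radius ((fps_deriv ^^ k) F) \<ge> fps_conv_radius F"
      by (induction k) (auto intro: order_trans fps_conv_radius_deriv)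
    then have "ereal r < fps_conv_radius ((fps_deriv ^^ k) F)" using r False by auto
    then show ?thesis using r False b by (intro fps_cauchy_bound) auto
  qed
  \<comment> \<open>Estimate \<open>c\<close> at coefficient \<open>N - k\<close> bounds the k-th
    term of the binomial expansion of (r + \<rho>)^N, times coefficient \<open>N\<close> of
    \<open>F\<close>.\<close>
  have t: "real (N choose k) * \<rho> ^ k * r ^ (N - k) * cmod (fps_nth F N) \<le> C" if "k \<le> N" for k
  proof -
    have *: "fact (N - k) * cmod (fps_nth ((fps_deriv ^^ k) F) (N - k)) = fact N * cmod (fps_nth F N)"
      using arg_cong[OF fps_nth_deriv_iterate[of "N - k" k F], of cmod] that by (simp add: norm_mult)
    have "cmod (fps_nth ((fps_deriv ^^ k) F) (N - k)) = real (N choose k) * fact k * cmod (fps_nth F N)"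
    proof -
      have N: "(fact N :: real) = fact k * fact (N - k) * real (N choose k)"
        using binomial_fact_lemma[OF that] by (metis of_nat_fact of_nat_mult)
      have "fact (N - k) * cmod (fps_nth ((fps_deriv ^^ k) F) (N - k))
          = fact (N - k) * (real (N choose k) * fact k * cmod (fps_nth F N))"
        unfolding * N by (simp only: mult_ac)
      then show ?thesis by simp
    qed
    with c[of k "N - k"] have "fact k * (real (N choose k) * r ^ (N - k) * cmod (fps_nth F N)) \<le> fact k * (C / \<rho> ^ k)"
      by (simp add: mult_ac)
    then have "real (N choose k) * r ^ (N - k) * cmod (fps_nth F N) \<le> C / \<rho> ^ k"
      by (rule mult_left_le_imp_le) simp
    then show ?thesis using \<rho> by (simp add: field_simps)
  qed
  have "cmod (fps_nth F N) * (r + \<rho>) ^ N = (\<Sum>k\<le>N. real (N choose k) * \<rho> ^ k * r ^ (N - k) * cmod (fps_nth F N))"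
    by (simp add: binomial_ring[of \<rho> r] add.commute sum_distrib_left mult_ac)
  also have "\<dots> \<le> (\<Sum>k\<le>N. C)" by (intro sum_mono t) auto
  finally show "cmod (fps_nth F N) * (r + \<rho>) ^ N \<le> real (Suc N) * C" by simp
qed

lemma eval_fps_bev:
  assumes r: "ereal r \<le> fps_conv_radius X" "ereal r \<le> fps_conv_radius Y" and s: "cmod s < r"
  shows "ereal r \<le> fps_conv_radius (bev fps_const g X Y) \<and>
    eval_fps (bev fps_const g X Y) s = beval g (eval_fps X s) (eval_fps Y s)"
proof (induction g rule: bipoly_induct)
  case (add f g)
  let ?f = "bev fps_const f X Y" and ?g = "bev fps_const g X Y"
  from add have lt: "ereal (cmod s) < fps_conv_radius ?f" "ereal (cmod s) < fps_conv_radius ?g"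
    using s by (meson ereal_less_eq(3) less_ereal.simps(1) less_le_trans)+
  have "ereal r \<le> fps_conv_radius (?f + ?g)"
    using add fps_conv_radius_add[of ?f ?g] by (meson min.boundedI order_trans)
  then show ?case using add lt by (simp add: bev_hom eval_fps_add)
next
  case (mult f g)
  let ?f = "bev fps_const f X Y" and ?g = "bev fps_const g X Y"
  from mult have lt: "ereal (cmod s) < fps_conv_radius ?f" "ereal (cmod s) < fps_conv_radius ?g"
    using s by (meson ereal_less_eq(3) less_ereal.simps(1) less_le_trans)+
  have "ereal r \<le> fps_conv_radius (?f * ?g)"
    using mult fps_conv_radius_mult[of ?f ?g] by (meson min.boundedI order_trans)
  then show ?case using mult lt by (simp add: bev_hom eval_fps_mult)
qed (use r in simp_all)

context ckeller
begin

lemma flow_deriv_iterate: "(fps_deriv ^^ k) (flow x0 y0 g) = flow x0 y0 ((Dt ^^ k) g)"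
  by (induction k) (simp_all add: fps_deriv_flow)

text \<open>On circles inside the known disc and of radius at most 2, the flow stays on the curve
  with \<open>Q\<close> within 2 of its initial value. It is therefore bounded by \<open>B\<close>,
  the derivative bounds are uniform, and every extension gains the same
  \<open>\<rho>\<close>.\<close>

lemma flow_conv_radius:
  assumes P0: "beval P x0 y0 = 0"
    and B: "\<And>x y. beval P x y = 0 \<Longrightarrow> beval Q x y \<in> cball (beval Q x0 y0) 2 \<Longrightarrow> cmod x \<le> B \<and> cmod y \<le> B"
  shows "fps_conv_radius (flow x0 y0 xv) \<ge> 2 \<and> fps_conv_radius (flow x0 y0 yv) \<ge> 2"
proof -
  define X where "X = flow x0 y0 xv"
  define Y where "Y = flow x0 y0 yv"
  have "max 1 B \<ge> 1" by simp
  from Dt_power_bound[OF this] obtain \<rho> C where \<rho>: "\<rho> > 0" "C \<ge> 0"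
    and bd: "\<forall>k x y. cmod x \<le> max 1 B \<and> cmod y \<le> max 1 B \<longrightarrow>
     cmod (beval ((Dt ^^ k) xv) x y) \<le> C * fact k / \<rho> ^ k \<and>
     cmod (beval ((Dt ^^ k) yv) x y) \<le> C * fact k / \<rho> ^ k" by (elim exE conjE)
  have ev: "(fps_deriv ^^ k) (flow x0 y0 g) = bev fps_const ((Dt ^^ k) g) X Y" for k g
    unfolding X_def Y_def flow_eq_bev[symmetric] by (rule flow_deriv_iterate)
  have step: "ereal (r' + \<rho>) \<le> fps_conv_radius X \<and> ereal (r' + \<rho>) \<le> fps_conv_radius Y"
    if r: "ereal r \<le> fps_conv_radius X" "ereal r \<le> fps_conv_radius Y" "r \<le> 2" "0 \<le> r'" "r' = 0 \<or> r' < r"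
    for r r'
  proof -
    have vals: "eval_fps (bev fps_const g X Y) s = beval g (eval_fps X s) (eval_fps Y s)"
      if "cmod s = r'" for s g
    proof (cases "r' = 0")
      case True
      then show ?thesis using that by (simp add: eval_fps_at_0 fps_nth_bev)
    next
      case False
      then show ?thesis using eval_fps_bev[OF r(1,2), of s g] that r(5) by auto
    qed
    have cv: "cmod (eval_fps X s) \<le> max 1 B \<and> cmod (eval_fps Y s) \<le> max 1 B" if s: "cmod s = r'" for s
    proof -
      have "beval P (eval_fps X s) (eval_fps Y s) = 0"
        using vals[OF s, of P] P0 by (simp add: X_def Y_def flow_P)
      moreover have "beval Q (eval_fps X s) (eval_fps Y s) = beval Q x0 y0 + s"
        using vals[OF s, of Q] by (simp add: X_def Y_def flow_Q eval_fps_add)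
      moreover have "cmod s \<le> 2" using s r by auto
      ultimately show ?thesis using B[of "eval_fps X s" "eval_fps Y s"] by (auto simp: dist_norm)
    qed
    have lt: "r' = 0 \<or> ereal r' < fps_conv_radius X" "r' = 0 \<or> ereal r' < fps_conv_radius Y"
      using r by (auto intro: less_le_trans[of _ "ereal r"])
    have "ereal (r' + \<rho>) \<le> fps_conv_radius X"
    proof (rule conv_radius_extend[OF r(4) lt(1) \<rho>])
      fix k s assume s: "cmod s = r'"
      show "cmod (eval_fps ((fps_deriv ^^ k) X) s) \<le> C * fact k / \<rho> ^ k"
        unfolding ev[of k xv, folded X_def] vals[OF s] using bd cv[OF s] by blast
    qed
    moreover have "ereal (r' + \<rho>) \<le> fps_conv_radius Y"
    proof (rule conv_radius_extend[OF r(4) lt(2) \<rho>])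
      fix k s assume s: "cmod s = r'"
      show "cmod (eval_fps ((fps_deriv ^^ k) Y) s) \<le> C * fact k / \<rho> ^ k"
        unfolding ev[of k yv, folded Y_def] vals[OF s] using bd cv[OF s] by blast
    qed
    ultimately show ?thesis ..
  qed
  have it: "ereal (min 2 (real j * \<rho> / 2)) \<le> fps_conv_radius X \<and> ereal (min 2 (real j * \<rho> / 2)) \<le> fps_conv_radius Y" for j
  proof (induction j)
    case 0
    then show ?case by (simp add: fps_conv_radius_def conv_radius_nonneg zero_ereal_def[symmetric])
  next
    case (Suc j)
    define r where "r = min 2 (real j * \<rho> / 2)"
    \<comment> \<open>Retreating by \<open>\<rho> / 2\<close> to lie strictly inside the disc and
      then gaining \<open>\<rho>\<close> nets \<open>\<rho> / 2\<close> per round; the first round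
      starts at radius 0.\<close>
    define r' where "r' = max 0 (r - \<rho> / 2)"
    have "min 2 (real (Suc j) * \<rho> / 2) \<le> r' + \<rho>"
    proof -
      have "real (Suc j) * \<rho> / 2 = real j * \<rho> / 2 + \<rho> / 2" by (simp add: field_simps)
      then have "min 2 (real (Suc j) * \<rho> / 2) \<le> r + \<rho> / 2" using \<rho> unfolding r_def by linarith
      also have "\<dots> \<le> r' + \<rho>" unfolding r'_def by linarith
      finally show ?thesis .
    qed
    moreover have "ereal (r' + \<rho>) \<le> fps_conv_radius X \<and> ereal (r' + \<rho>) \<le> fps_conv_radius Y"
      by (rule step[of r]) (use Suc \<rho> in \<open>auto simp: r_def[symmetric] r'_def\<close>, auto simp: r_def)
    ultimately show ?case by (meson ereal_less_eq(3) order_trans)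
  qed
  obtain j where "real j > 4 / \<rho>" using reals_Archimedean2 by blast
  then have "min 2 (real j * \<rho> / 2) = 2" using \<rho> by (simp add: field_simps min_def)
  then show ?thesis using it[of j] by (simp add: X_def Y_def)
qed

end

text \<open>A radius above 1 makes the coefficients tend to 0, and a Gaussian integer of modulus
  below 1 is 0.\<close>

lemma gaussian_fps_polynomial:
  assumes G: "\<And>n. fps_nth F n \<in> gaussian_ints" and R: "fps_conv_radius F \<ge> 2"
  shows "\<exists>p. F = fps_of_poly p"
proof -
  have "ereal (cmod 1) < fps_conv_radius F" using R
    by (metis less_le_trans norm_one one_less_numeral_iff numeral_eq_ereal semiring_norm(76) less_ereal.simps(1))
  then have "summable (\<lambda>n. fps_nth F n * 1 ^ n)" by (intro summable_fps) simp
  then have "(\<lambda>n. fps_nth F n) \<longlonglongrightarrow> 0" using summable_LIMSEQ_zero by fastforce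
  then have "eventually (\<lambda>n. cmod (fps_nth F n) < 1) sequentially"
    by (auto dest: tendstoD[of _ _ _ 1])
  then obtain N where N: "\<And>n. n \<ge> N \<Longrightarrow> cmod (fps_nth F n) < 1" by (auto simp: eventually_sequentially)
  have z: "fps_nth F n = 0" if "n \<ge> N" for n
  proof -
    have "\<bar>Re (fps_nth F n)\<bar> < 1" "\<bar>Im (fps_nth F n)\<bar> < 1"
      using N[OF that] abs_Re_le_cmod[of "fps_nth F n"] abs_Im_le_cmod[of "fps_nth F n"] by linarith+
    then show ?thesis using G[of n] unfolding gaussian_iff complex_eq_iff
      by (auto elim!: Ints_cases)
  qed
  define p where "p = Abs_poly (fps_nth F)"
  have "\<forall>\<^sub>\<infinity> n. fps_nth F n = 0" using z unfolding MOST_nat by (metis less_imp_le)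
  then have "coeff p = fps_nth F" unfolding p_def by (simp add: Abs_poly_inverse)
  then show ?thesis by (intro exI[of _ p] fps_ext) simp
qed

section \<open>Integrality of the inverse\<close>

lemma rhom_fps_of_poly: "rhom (fps_of_poly :: complex poly \<Rightarrow> _)"
  by (simp add: rhom_def fps_of_poly_add fps_of_poly_mult)

lemma (in ckeller) integral_line:
  assumes P: "coeffs_in gaussian_ints P" and Q: "coeffs_in gaussian_ints Q"
    and inf: "infinite {(x, y). x \<in> gaussian_ints \<and> y \<in> gaussian_ints \<and> beval P x y = 0}"
  shows "\<exists>x0 y0 a b. x0 \<in> gaussian_ints \<and> y0 \<in> gaussian_ints \<and> beval P x0 y0 = 0 \<and>
    bev (\<lambda>c. [:c:]) P a b = 0 \<and> bev (\<lambda>c. [:c:]) Q a b = [:beval Q x0 y0, 1:]"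
proof -
  from good_point[OF Q inf] obtain x0 y0 B where x0: "x0 \<in> gaussian_ints" and y0: "y0 \<in> gaussian_ints"
    and P0: "beval P x0 y0 = 0"
    and B: "\<forall>x y. beval P x y = 0 \<and> beval Q x y \<in> cball (beval Q x0 y0) 2 \<longrightarrow> cmod x \<le> B \<and> cmod y \<le> B"
    by (elim exE conjE)
  have R: "fps_conv_radius (flow x0 y0 xv) \<ge> 2 \<and> fps_conv_radius (flow x0 y0 yv) \<ge> 2"
    using B by (intro flow_conv_radius[OF P0]) blast
  note int = flow_integral[OF subring_gaussian P Q x0 y0]
  obtain a b where a: "flow x0 y0 xv = fps_of_poly a" and b: "flow x0 y0 yv = fps_of_poly b"
    using gaussian_fps_polynomial[OF int[THEN conjunct1] R[THEN conjunct1]]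
      gaussian_fps_polynomial[OF int[THEN conjunct2] R[THEN conjunct2]] by blast
  have ev: "bev fps_const g (fps_of_poly a) (fps_of_poly b) = fps_of_poly (bev (\<lambda>c. [:c:]) g a b)" for g
    using rhom_bev_commute[OF rhoms(2) rhom_fps_of_poly, of g a b] by (simp add: fps_of_poly_const)
  have "fps_of_poly (bev (\<lambda>c. [:c:]) P a b) = fps_of_poly 0"
    using flow_P[of x0 y0] P0 unfolding a b ev by simp
  then have "bev (\<lambda>c. [:c:]) P a b = 0" by (simp only: fps_of_poly_eq_iff)
  moreover have "fps_of_poly (bev (\<lambda>c. [:c:]) Q a b) = fps_of_poly [:beval Q x0 y0, 1:]"
    using flow_Q[of x0 y0] unfolding a b ev by (simp add: fps_of_poly_pCons)
  then have "bev (\<lambda>c. [:c:]) Q a b = [:beval Q x0 y0, 1:]" by (simp only: fps_of_poly_eq_iff)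
  ultimately show ?thesis using x0 y0 P0 by blast
qed

text \<open>Kronecker substitution x = s^N, y = s: with y-degrees below \<open>N\<close>, distinct
  monomials get distinct exponents, by uniqueness of division with remainder.\<close>

lemma kronecker_coeff:
  fixes G :: "complex poly poly"
  assumes N: "degree G < N" and j: "j < N"
  shows "fps_nth (bev fps_const G (fps_X ^ N) fps_X) (N * i + j) = coeff (coeff G j) i"
proof -
  have inner: "fps_nth (poly (map_poly fps_const p) (fps_X ^ N)) m = (if N dvd m then coeff p (m div N) else 0)"
    for p :: "complex poly" and m
  proof (induction p arbitrary: m)
    case (pCons a p)
    show ?case
    proof (cases "m < N")
      case True
      then have "N dvd m \<longleftrightarrow> m = 0" by (auto dest: dvd_imp_le)
      then show ?thesis using True N by (simp add: poly_map_pCons fps_X_power_mult_nth)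
    next
      case False
      then obtain k where "m = N + k" by (metis le_Suc_ex not_less)
      then show ?thesis using pCons(2)[of k] N by (auto simp: poly_map_pCons fps_X_power_mult_nth)
    qed
  qed simp
  let ?c = "\<lambda>l. poly (map_poly fps_const (coeff G l)) (fps_X ^ N)"
  have "bev fps_const G (fps_X ^ N) fps_X = (\<Sum>l\<le>N - 1. ?c l * fps_X ^ l)"
    unfolding bev_def using N by (intro poly_map_poly_sum) auto
  then have "fps_nth (bev fps_const G (fps_X ^ N) fps_X) (N * i + j)
      = (\<Sum>l\<le>N - 1. fps_nth (?c l * fps_X ^ l) (N * i + j))" by (simp add: fps_sum_nth)
  also have "\<dots> = (\<Sum>l\<le>N - 1. if l = j then coeff (coeff G j) i else 0)"
  proof (rule sum.cong[OF refl])
    fix l assume "l \<in> {..N - 1}"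
    then have l: "l < N" using N by auto
    have "N dvd N * i + j - l \<longleftrightarrow> l = j" if "l \<le> N * i + j"
    proof
      assume "N dvd N * i + j - l"
      then have "(N * i + j) mod N = l mod N" using mod_eq_dvd_iff_nat[OF that] by blast
      then show "l = j" using l j by simp
    qed simp
    then show "fps_nth (?c l * fps_X ^ l) (N * i + j) = (if l = j then coeff (coeff G j) i else 0)"
      using l j by (auto simp: fps_X_power_mult_right_nth inner)
  qed
  also have "\<dots> = coeff (coeff G j) i" using j by simp
  finally show ?thesis .
qed

text \<open>Along the flow of the pair \<open>(P - Q^N, Q)\<close> one has \<open>(P, Q) = (s^N, s)\<close>, so \<open>G(s^N, s)\<close> is integral.\<close>

lemma (in ckeller) integral_inverse:
  assumes S: "subring_of S" and P: "coeffs_in S P" and Q: "coeffs_in S Q"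
    and x0: "x0 \<in> S" and y0: "y0 \<in> S" and P0: "beval P x0 y0 = 0" and Q0: "beval Q x0 y0 = 0"
    and g: "g \<in> {xv, yv}" and G: "bcomp G P Q = g"
  shows "coeffs_in S G"
proof -
  define N where "N = Suc (degree G)"
  define P1 where "P1 = P - Q ^ N"
  \<comment> \<open>\<open>Du P1\<close> is the Jacobian of \<open>(P1, Q)\<close>, and subtracting
    a power of \<open>Q\<close> does not change it.\<close>
  have "Du (Q ^ n) = 0" for n by (induction n) (simp_all add: Du_simps)
  then have "Du P1 = 1" by (simp add: P1_def Du_simps)
  then interpret shear: ckeller P1 Q
    by unfold_locales (simp add: Du_def mult.commute)
  let ?X = "shear.flow x0 y0 xv" and ?Y = "shear.flow x0 y0 yv"
  note sub = subring_coeffs_in[OF S]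
  have P1: "coeffs_in S P1"
    using subringD(4)[OF sub _ subring_power[OF sub]] P Q by (simp add: P1_def)
  have "fps_nth (shear.flow x0 y0 g) n \<in> S" for n
    using shear.flow_integral[OF S P1 Q x0 y0, of n] g by auto
  moreover have "shear.flow x0 y0 g = bev fps_const G (fps_X ^ N) fps_X"
  proof -
    have q: "bev fps_const Q ?X ?Y = fps_X" using shear.flow_Q[of x0 y0] Q0 by simp
    \<comment> \<open>\<open>N\<close> is positive, so \<open>Q ^ N\<close> vanishes at the base
      point together with \<open>Q\<close>.\<close>
    have "bev fps_const P1 ?X ?Y = 0"
      using shear.flow_P[of x0 y0] P0 Q0
      by (simp add: P1_def bev_hom rhom_power[OF rhom_bev[OF rhoms(1)]] N_def)
    then have "bev fps_const P ?X ?Y = fps_X ^ N"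
      by (simp add: P1_def bev_hom rhom_power[OF rhom_bev[OF rhoms(3)]] q[unfolded P1_def])
    then have "bev fps_const (bcomp G P Q) ?X ?Y = bev fps_const G (fps_X ^ N) fps_X"
      by (simp only: bev_bcomp[OF rhoms(3)] q)
    then show ?thesis unfolding G shear.flow_eq_bev[symmetric] .
  qed
  ultimately have K: "fps_nth (bev fps_const G (fps_X ^ N) fps_X) n \<in> S" for n by simp
  show ?thesis unfolding coeffs_in_def
  proof (intro allI)
    fix j i
    show "coeff (coeff G j) i \<in> S"
    proof (cases "j < N")
      case True
      then show ?thesis using K[of "N * i + j"] kronecker_coeff[of G N j i] by (simp add: N_def)
    next
      case False
      then show ?thesis using subringD(1)[OF S] by (simp add: N_def coeff_eq_0)
    qed
  qed
qed

section \<open>Descent from complex to integer coefficients\<close>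

lemma bev_map_poly:
  assumes "rhom h" "rhom k"
  shows "bev h (map_poly (map_poly k) g) X Y = bev (\<lambda>c. h (k c)) g X Y"
proof -
  have "rhom (map_poly (map_poly k))" using assms by (intro rhom_map_poly)
  then have m: "rhom (\<lambda>g. bev h (map_poly (map_poly k) g) X Y)"
    by (rule rhom_comp[OF _ rhom_bev[OF assms(1)]])
  show ?thesis
    by (induction g rule: bipoly_induct)
       (simp_all add: rhomD[OF m] bev_hom[OF rhom_comp[OF assms(2,1)]] rhom_comp[OF assms(2,1)]
         bev_vars assms map_poly_pCons rhomD)
qed

abbreviation cx :: "int poly poly \<Rightarrow> complex poly poly" where
  "cx \<equiv> map_poly (map_poly of_int)"

lemma rhom_cx: "rhom cx"
  by (intro rhom_map_poly rhoms)

lemma coeff_cx: "coeff (coeff (cx g) i) j = of_int (coeff (coeff g i) j)"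
  by (simp add: coeff_map_poly)

lemma bipoly_eqI: "(\<And>i j. coeff (coeff f i) j = coeff (coeff g i) j) \<Longrightarrow> f = g"
  by (simp add: poly_eq_iff)

lemma cx_derivs: "px (cx g) = cx (px g)" "py (cx g) = cx (py g)"
  by (rule bipoly_eqI; simp add: coeff_px coeff_pderiv coeff_cx of_nat_poly)+

lemma cx_bcomp: "cx (bcomp g U V) = bcomp (cx g) (cx U) (cx V)"
proof -
  have "cx (bcomp g U V) = bev (\<lambda>c. cx [:[:c:]:]) g (cx U) (cx V)"
    by (rule rhom_bev_commute[OF rhom_cc rhom_cx])
  also have "\<dots> = bcomp (cx g) (cx U) (cx V)"
    by (subst bev_map_poly) (simp_all add: map_poly_pCons)
  finally show ?thesis .
qed

text \<open>Split G = A + iB with integer polynomials; since \<open>P\<close> and \<open>Q\<close>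
  are integral, the real part of G(P, Q) is A(P, Q).\<close>

lemma real_part_inverse:
  assumes S: "coeffs_in gaussian_ints G" and G: "bcomp G (cx P) (cx Q) = cx g"
  shows "\<exists>A. bcomp A P Q = g"
proof -
  define A where "A = map_poly (map_poly (\<lambda>z. \<lfloor>Re z\<rfloor>)) G"
  define B where "B = map_poly (map_poly (\<lambda>z. \<lfloor>Im z\<rfloor>)) G"
  have G_eq: "G = cx A + [:[:\<i>:]:] * cx B"
  proof (rule bipoly_eqI)
    fix i j
    have "coeff (coeff G i) j \<in> gaussian_ints" using S by (simp add: coeffs_in_def)
    then show "coeff (coeff G i) j = coeff (coeff (cx A + [:[:\<i>:]:] * cx B) i) j"
      by (auto simp: coeff_cx A_def B_def coeff_map_poly gaussian_iff complex_eq_iff elim!: Ints_cases)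
  qed
  have "cx (bcomp A P Q) + [:[:\<i>:]:] * cx (bcomp B P Q) = cx g"
    using G unfolding G_eq bev_hom(3,4)[OF rhom_cc] bev_vars(3)[OF rhom_cc] cx_bcomp .
  then have "coeff (coeff (cx (bcomp A P Q) + [:[:\<i>:]:] * cx (bcomp B P Q)) i) j = coeff (coeff (cx g) i) j" for i j
    by simp
  then have "Re (coeff (coeff (cx (bcomp A P Q) + [:[:\<i>:]:] * cx (bcomp B P Q)) i) j) = Re (coeff (coeff (cx g) i) j)" for i j
    by (rule arg_cong)
  then have "bcomp A P Q = g" by (intro bipoly_eqI) (simp add: coeff_cx)
  then show ?thesis by blast
qed

theorem theorem1:
  fixes P Q :: bipoly
  assumes "jacobian P Q = 1"
    and "infinite {(x, y). x \<in> gaussian_ints \<and> y \<in> gaussian_ints \<and> eval2 P x y = 0}"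
  shows "\<exists>G H :: bipoly.
           (\<forall>x y. eval2 G (eval2 P x y) (eval2 Q x y) = x \<and> eval2 H (eval2 P x y) (eval2 Q x y) = y) \<and>
           (\<forall>u v. eval2 P (eval2 G u v) (eval2 H u v) = u \<and> eval2 Q (eval2 G u v) (eval2 H u v) = v)"
proof -
  have eval2: "eval2 g x y = bev of_int g x y" for g x y
    by (simp add: eval2_def bev_def)
  have jac: "px P * py Q - py P * px Q = 1"
    using assms(1) by (simp add: Defs.jacobian_def dx_def dy_def px_def)
  interpret Z: keller P Q by unfold_locales (rule jac)
  have "cx (px P * py Q - py P * px Q) = cx 1" unfolding jac ..
  then interpret C: ckeller "cx P" "cx Q"
    by unfold_locales (simp add: cx_derivs rhomD[OF rhom_cx])
  have cxG: "coeffs_in gaussian_ints (cx g)" for g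
    by (simp add: coeffs_in_def coeff_cx gaussian_iff)
  have "infinite {(x, y). x \<in> gaussian_ints \<and> y \<in> gaussian_ints \<and> beval (cx P) x y = 0}"
    using assms(2) by (simp add: eval2 bev_map_poly)
  from C.integral_line[OF cxG cxG this] obtain x0 y0 a b where x0: "x0 \<in> gaussian_ints"
    and y0: "y0 \<in> gaussian_ints" and P0: "beval (cx P) x0 y0 = 0"
    and Pab: "bev (\<lambda>c. [:c:]) (cx P) a b = 0"
    and Qab: "bev (\<lambda>c. [:c:]) (cx Q) a b = [:beval (cx Q) x0 y0, 1:]" by (elim exE conjE)
  \<comment> \<open>The shift by \<open>t0\<close> puts the base point over the origin and makes the
    value of \<open>Q0\<close> the parameter of the line.\<close>
  define t0 where "t0 = beval (cx Q) x0 y0"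
  define Q0 where "Q0 = cx Q - [:[:t0:]:]"
  have "px (cx P) * py Q0 - py (cx P) * px Q0 = 1"
    using C.jac by (simp add: Q0_def px_simps py_simps)
  then interpret L: keller_line "cx P" Q0 a b
    by unfold_locales (simp_all add: Q0_def Pab Qab bev_hom t0_def)
  note sub = subring_coeffs_in[OF subring_gaussian]
  have t0: "t0 \<in> gaussian_ints"
    using bev_in_subring[OF rhoms(1) subring_gaussian _ cxG x0 y0] by (simp add: t0_def)
  have const: "coeffs_in gaussian_ints [:[:t0:]:]"
    using t0 subringD(1)[OF subring_gaussian] by (auto simp: coeffs_in_def coeff_pCons split: nat.split)
  have Q0G: "coeffs_in gaussian_ints Q0"
    unfolding Q0_def using subringD(4)[OF sub] cxG const by simp
  have inv: "\<exists>A. bcomp A P Q = g" if g: "g \<in> {xv, yv}" for g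
  proof -
    obtain n where "(L.Dt ^^ n) (cx g) = 0" using L.Dt_locally_nilpotent by blast
    from L.Dt_nilpotent[OF this] obtain G where G: "bcomp G (cx P) Q0 = cx g" by blast
    have "cx g \<in> {xv, yv}" using g by (auto simp: map_poly_pCons)
    then have GG: "coeffs_in gaussian_ints G"
      using L.integral_inverse[OF subring_gaussian cxG Q0G x0 y0 P0 _ _ G]
      by (simp add: Q0_def bev_hom t0_def)
    \<comment> \<open>\<open>G\<close> expresses \<open>g\<close> in \<open>P\<close> and
      \<open>Q0\<close>; shifting its second variable by the Gaussian integer \<open>t0\<close>
      expresses \<open>g\<close> in \<open>P\<close> and \<open>Q\<close>.\<close>
    have "bcomp G xv (yv - [:[:t0:]:]) \<in> {g. coeffs_in gaussian_ints g}"
    proof (rule bev_in_subring[OF rhom_cc sub _ GG])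
      show "[:[:c:]:] \<in> {g. coeffs_in gaussian_ints g}" if "c \<in> gaussian_ints" for c
        using that subringD(1)[OF subring_gaussian] by (auto simp: coeffs_in_def coeff_pCons split: nat.split)
      have "xv = cx xv" "yv = cx yv" by (simp_all add: map_poly_pCons)
      then have v: "coeffs_in gaussian_ints xv" "coeffs_in gaussian_ints yv" using cxG by metis+
      show "xv \<in> {g. coeffs_in gaussian_ints g}" using v by simp
      show "yv - [:[:t0:]:] \<in> {g. coeffs_in gaussian_ints g}"
        by (intro subringD(4)[OF sub]) (use v const in simp_all)
    qed
    moreover have "bcomp (bcomp G xv (yv - [:[:t0:]:])) (cx P) (cx Q) = cx g"
    proof -
      have "bcomp (yv - [:[:t0:]:]) (cx P) (cx Q) = Q0"
        unfolding bev_hom(6)[OF rhom_cc] bev_vars[OF rhom_cc] Q0_def ..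
      then show ?thesis unfolding bev_bcomp[OF rhom_cc] bev_vars(1)[OF rhom_cc] using G by simp
    qed
    ultimately show ?thesis using real_part_inverse by blast
  qed
  obtain A where A: "bcomp A P Q = xv" using inv[of xv] by blast
  obtain B where B: "bcomp B P Q = yv" using inv[of yv] by blast
  \<comment> \<open>The left inverse is two-sided: these differences vanish after substituting
    \<open>(P, Q)\<close>, and that substitution is injective by algebraic independence.\<close>
  have "bcomp (bcomp P A B - xv) P Q = 0" "bcomp (bcomp Q A B - yv) P Q = 0"
    by (simp_all add: bev_hom bev_bcomp A B)
  then have PA: "bcomp P A B = xv" and QA: "bcomp Q A B = yv" by (simp_all add: Z.bcomp_eq_0_iff)
  have comp: "bev of_int f (bev of_int U x y) (bev of_int V x y) = bev of_int (bcomp f U V) x y"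
    for f U V :: bipoly and x y :: complex
    by (simp add: bev_bcomp)
  show ?thesis
    by (rule exI[of _ A], rule exI[of _ B]) (simp add: eval2 comp A B PA QA)
qed

end
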